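(* Let $N$ and $k$ be positive integers, $\mathbf N=(N,N,\dots,N)$ with $k$ entries, and define $$F_{\mathbf N}(z)=\sum_{m=0}^\infty\frac{(Nm)!^k}{m!^{kN}}z^m,\qquad G_{N,\mathbf N}(z)=\sum_{m=1}^\infty H_{Nm}\frac{(Nm)!^k}{m!^{kN}}z^m,\qquad q_{N,\mathbf N}(z)=\exp\big(G_{N,\mathbf N}(z)/F_{\mathbf N}(z)\big).$$ Let $\Xi_1=1$, $\Xi_7=1/140$, and for $N\notin\{1,7\}$ $$\Xi_N=\prod_{p\le N,\ p\text{ prime}}p^{\min\{2+\xi(p,N),\,v_p(H_N)\}},$$ where $\xi(p,N)=1$ if $p$ is a Wolstenholme prime or $p$ divides $N$, and $\xi(p,N)=0$ otherwise. Then $q_{N,\mathbf N}(z)^{\frac{1}{\Xi_N\,N!^k}}\in\mathbb{Z}[[z]]$.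
   Context: $H_n=\sum_{i=1}^n1/i$; $v_p$ denotes the $p$-adic valuation on $\mathbb{Q}$. A Wolstenholme prime is a prime $p$ with $v_p(H_{p-1})\ge3$. For $f\in1+z\mathbb{Q}[[z]]$ and rational $c$, $f^c:=\exp(c\log f)$ as formal power series. Note $\Xi_N$ is a positive rational number (possibly not an integer). *)

theory Defs
  imports "HOL-Computational_Algebra.Computational_Algebra"
begin

(* The library's harm needs a real_normed_field, which rat is not. *)
definition harmonic :: "nat \<Rightarrow> rat" where
  "harmonic n = (\<Sum>i=1..n. 1 / of_nat i)"

(* For prime p and x \<noteq> 0; at x = 0 the value is the junk value 0 instead of infinity. *)
definition padic_val :: "nat \<Rightarrow> rat \<Rightarrow> int" where
  "padic_val p x =
     int (multiplicity (int p) (fst (quotient_of x))) -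
     int (multiplicity (int p) (snd (quotient_of x)))"

definition wolstenholme_prime :: "nat \<Rightarrow> bool" where
  "wolstenholme_prime p \<longleftrightarrow> prime p \<and> padic_val p (harmonic (p - 1)) \<ge> 3"

(* The composition oo is the usual one only if its right argument has constant term 0.
   fps_exp 1 is the series exp X, and fps_ln 1 is log (1 + X). *)
definition fps_rat_power :: "rat fps \<Rightarrow> rat \<Rightarrow> rat fps" where
  "fps_rat_power f c = fps_exp 1 oo (fps_const c * (fps_ln 1 oo (f - 1)))"

definition F_series :: "nat \<Rightarrow> nat \<Rightarrow> rat fps" where
  "F_series N k = Abs_fps (\<lambda>m. fact (N * m) ^ k / fact m ^ (k * N))"

definition G_series :: "nat \<Rightarrow> nat \<Rightarrow> rat fps" where
  "G_series N k = Abs_fps (\<lambda>m.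
     if m = 0 then 0 else harmonic (N * m) * (fact (N * m) ^ k / fact m ^ (k * N)))"

definition q_series :: "nat \<Rightarrow> nat \<Rightarrow> rat fps" where
  "q_series N k = fps_exp 1 oo (G_series N k / F_series N k)"

definition xi :: "nat \<Rightarrow> nat \<Rightarrow> int" where
  "xi p N = (if wolstenholme_prime p \<or> p dvd N then 1 else 0)"

definition Xi :: "nat \<Rightarrow> rat" where
  "Xi N =
     (if N = 1 then 1
      else if N = 7 then 1 / 140
      else (\<Prod>p | prime p \<and> p \<le> N.
              of_nat p powi min (2 + xi p N) (padic_val p (harmonic N))))"

end

theory Submission
  imports Defs "HOL-Number_Theory.Cong"
begin

text \<open>
  Let \<open>F\<close>, \<open>G\<close> be the two series, \<open>B\<^sub>m = ((Nm)! / m!\<^sup>N)\<^sup>k\<close>, and fix a prime \<open>p\<close>;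
  let \<open>h\<close> be the exponent of \<open>p\<close> in \<open>\<Xi>\<^sub>N\<close>. By Dwork's criterion
  (\<open>exp g\<close> is \<open>p\<close>-integral as soon as \<open>g(z\<^sup>p) - p g(z)\<close> is divisible by \<open>p\<close>) it is enough that
  \<open>F(z) G(z\<^sup>p) - p G(z) F(z\<^sup>p)\<close> is divisible by \<open>p\<^sup>h\<^sup>+\<^sup>1 N!\<^sup>k\<close>. Since
  \<open>p H\<^sub>p\<^sub>n\<close> and \<open>H\<^sub>n\<close> differ by \<open>p\<close> times a sum of inverses of units, the coefficients of this series reduce to
  \<open>\<Sum>\<^sub>j H\<^sub>N\<^sub>j (B\<^sub>j B\<^sub>a\<^sub>+\<^sub>p\<^sub>(\<^sub>K\<^sub>-\<^sub>j\<^sub>) - B\<^sub>K\<^sub>-\<^sub>j B\<^sub>a\<^sub>+\<^sub>p\<^sub>j)\<close>, which is summed by parts along the base \<open>p\<close>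
  expansion of \<open>j\<close> and estimated by Dwork's congruences for block sums of the bracket.

  What this needs from \<open>h\<close> is that \<open>p\<^sup>h\<close> divides \<open>H\<^sub>N\<close>, that \<open>p\<^sup>h\<close> divides every sum of \<open>1/i\<close> over \<open>i \<le> pNx\<close>
  prime to \<open>p\<close> (this sum is \<open>(Nx)\<^sup>2 H\<^sub>p\<^sub>-\<^sub>1\<close> modulo \<open>p\<^sup>3\<close>, whence the bound \<open>2 + \<xi>(p, N)\<close>), and that
  \<open>p\<^sup>h\<^sup>+\<^sup>L\<close> divides \<open>N!\<close> where \<open>p\<^sup>L \<le> N < p\<^sup>L\<^sup>+\<^sup>1\<close>. The last condition only matters for \<open>h \<ge> 1\<close>, and then
  \<open>p\<close> divides the numerator of \<open>H\<^sub>c\<close> for \<open>c = \<lfloor>N/p\<rfloor>\<close>, so \<open>c\<close> cannot be small.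
\<close>

section \<open>Lower bounds for p-adic valuations of rationals\<close>

text \<open>\<open>val_ge p n 0\<close> holds for every \<open>n\<close>, unlike \<open>n \<le> padic_val p 0\<close>.\<close>
definition val_ge :: "nat \<Rightarrow> int \<Rightarrow> rat \<Rightarrow> bool" where
  "val_ge p n x \<longleftrightarrow>
     (\<exists>a b. \<not> int p dvd b \<and> x = of_nat p powi n * (of_int a / of_int b))"

locale prime_nat =
  fixes p :: nat
  assumes prime_p: "prime p"
begin

lemma p_gt_1: "p > 1" using prime_p prime_gt_1_nat by blast

lemma prime_int_p: "prime (int p)" using prime_p by simp

lemma of_nat_p_nonzero [simp]: "(of_nat p :: rat) \<noteq> 0" using p_gt_1 by simp

lemma p_nonzero [simp]: "p \<noteq> 0" using p_gt_1 by simp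

lemma val_ge_0I: "\<not> int p dvd b \<Longrightarrow> val_ge p 0 (of_int a / of_int b)"
  unfolding val_ge_def by auto

text \<open>Dividing by the power of \<open>p\<close> reduces every valuation bound to
  p-integrality, so closure under sums and products is checked at level 0 only.\<close>

lemma val_ge_iff_0: "val_ge p n x \<longleftrightarrow> val_ge p 0 (x / of_nat p powi n)"
proof -
  have "(of_nat p :: rat) powi n \<noteq> 0" by simp
  hence "x = of_nat p powi n * y \<longleftrightarrow> x / of_nat p powi n = y" for y :: rat
    by (auto simp: field_simps)
  thus ?thesis unfolding val_ge_def by (simp only: power_int_0_right mult_1)
qed

lemma val_ge_0_add: "val_ge p 0 x \<Longrightarrow> val_ge p 0 y \<Longrightarrow> val_ge p 0 (x + y)"
proof -
  assume "val_ge p 0 x" "val_ge p 0 y"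
  then obtain a b c d where *: "\<not> int p dvd b" "\<not> int p dvd d" "x = of_int a / of_int b" "y = of_int c / of_int d"
    unfolding val_ge_def by auto
  hence nz: "b \<noteq> 0" "d \<noteq> 0" by auto
  have "\<not> int p dvd b * d" using * prime_int_p by (simp add: prime_dvd_mult_iff)
  moreover have "x + y = of_int (a * d + c * b) / of_int (b * d)"
    using * nz by (simp add: field_simps)
  ultimately show ?thesis using val_ge_0I by metis
qed

lemma val_ge_0_mult: "val_ge p 0 x \<Longrightarrow> val_ge p 0 y \<Longrightarrow> val_ge p 0 (x * y)"
proof -
  assume "val_ge p 0 x" "val_ge p 0 y"
  then obtain a b c d where *: "\<not> int p dvd b" "\<not> int p dvd d" "x = of_int a / of_int b" "y = of_int c / of_int d"
    unfolding val_ge_def by auto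
  have "\<not> int p dvd b * d" using * prime_int_p by (simp add: prime_dvd_mult_iff)
  moreover have "x * y = of_int (a * c) / of_int (b * d)"
    using * by (simp add: field_simps)
  ultimately show ?thesis using val_ge_0I by metis
qed

lemma val_ge_add: "val_ge p n x \<Longrightarrow> val_ge p n y \<Longrightarrow> val_ge p n (x + y)"
  using val_ge_0_add[of "x / of_nat p powi n" "y / of_nat p powi n"]
  by (simp add: val_ge_iff_0[of n] add_divide_distrib)

lemma val_ge_mult: "val_ge p n x \<Longrightarrow> val_ge p m y \<Longrightarrow> val_ge p (n + m) (x * y)"
  using val_ge_0_mult[of "x / of_nat p powi n" "y / of_nat p powi m"]
  by (simp add: val_ge_iff_0[of n] val_ge_iff_0[of m] val_ge_iff_0[of "n + m"] power_int_add)

lemma val_ge_mult_0: "val_ge p n x \<Longrightarrow> val_ge p 0 y \<Longrightarrow> val_ge p n (x * y)"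
  using val_ge_mult[of n x 0 y] by simp

lemma val_ge_0_mult': "val_ge p 0 x \<Longrightarrow> val_ge p n y \<Longrightarrow> val_ge p n (x * y)"
  using val_ge_mult[of 0 x n y] by simp

lemma not_p_dvd_1 [simp]: "\<not> int p dvd 1" "p \<noteq> Suc 0" "\<not> p dvd Suc 0"
  using p_gt_1 by auto

lemma val_ge_of_int [simp]: "val_ge p 0 (of_int a)"
  using val_ge_0I[of 1 a] by simp

lemma val_ge_of_nat [simp]: "val_ge p 0 (of_nat a)"
  using val_ge_of_int[of "int a"] by simp

lemma val_ge_0_1 [simp]: "val_ge p 0 1" using val_ge_of_int[of 1] by simp

lemma val_ge_numeral [simp]: "val_ge p 0 (numeral k)"
  using val_ge_of_nat[of "numeral k"] by (simp del: val_ge_of_nat)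

lemma val_ge_fact [simp]: "val_ge p 0 (fact n)"
  using val_ge_of_nat[of "fact n"] by (simp del: val_ge_of_nat)

lemma val_ge_zero [simp]: "val_ge p n 0"
  unfolding val_ge_def by (intro exI[of _ 0] exI[of _ 1]) simp

lemma val_ge_minus [simp]: "val_ge p n (- x) \<longleftrightarrow> val_ge p n x"
  using val_ge_mult_0[of n x "of_int (-1)", OF _ val_ge_of_int] val_ge_mult_0[of n "- x" "of_int (-1)", OF _ val_ge_of_int]
  by auto

lemma val_ge_diff: "val_ge p n x \<Longrightarrow> val_ge p n y \<Longrightarrow> val_ge p n (x - y)"
  using val_ge_add[of n x "- y"] by simp

lemma val_ge_sum: "(\<And>i. i \<in> I \<Longrightarrow> val_ge p n (f i)) \<Longrightarrow> val_ge p n (\<Sum>i\<in>I. f i)"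
  by (induction I rule: infinite_finite_induct) (auto intro: val_ge_add)

lemma val_ge_prod: "(\<And>i. i \<in> I \<Longrightarrow> val_ge p 0 (f i)) \<Longrightarrow> val_ge p 0 (\<Prod>i\<in>I. f i)"
  by (induction I rule: infinite_finite_induct) (auto intro: val_ge_0_mult)

lemma val_ge_power: "val_ge p 0 x \<Longrightarrow> val_ge p 0 (x ^ k)"
  by (induction k) (auto intro: val_ge_0_mult)

lemma val_ge_p_powi [simp]: "val_ge p n (of_nat p powi n)"
  by (simp add: val_ge_iff_0[of n])

lemma val_ge_p_power [simp]: "val_ge p (int n) (of_nat p ^ n)"
  using val_ge_p_powi[of "int n"] by (simp add: power_int_def)

lemma val_ge_p [simp]: "val_ge p 1 (of_nat p)"
  using val_ge_p_power[of 1] by simp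

lemma val_ge_mono: "val_ge p n x \<Longrightarrow> m \<le> n \<Longrightarrow> val_ge p m x"
proof -
  assume *: "val_ge p n x" "m \<le> n"
  define k where "k = nat (n - m)"
  have "n = m + int k" using * by (simp add: k_def)
  hence "x / of_nat p powi m = x / of_nat p powi n * of_nat (p ^ k)"
    by (simp add: power_int_add)
  moreover have "val_ge p 0 (x / of_nat p powi n * of_nat (p ^ k))"
    using * val_ge_iff_0 by (intro val_ge_0_mult val_ge_of_nat) simp
  ultimately show ?thesis using val_ge_iff_0[of m x] by simp
qed

lemma val_ge_divide_p_powi: "val_ge p (n + m) x \<Longrightarrow> val_ge p n (x / of_nat p powi m)"
  by (simp add: val_ge_iff_0[of n] val_ge_iff_0[of "n + m"] power_int_add mult.commute)

lemma val_ge_p_times: "val_ge p n (of_nat p * x) \<longleftrightarrow> val_ge p (n - 1) x"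
  by (simp add: val_ge_iff_0[of n] val_ge_iff_0[of "n - 1"] power_int_diff field_simps)

lemma val_ge_1_over_int: "\<not> int p dvd b \<Longrightarrow> val_ge p 0 (1 / of_int b)"
  using val_ge_0I[of b 1] by simp

lemma val_ge_1_over_nat: "\<not> p dvd b \<Longrightarrow> val_ge p 0 (1 / of_nat b)"
  using val_ge_1_over_int[of "int b"] by simp

lemma val_ge_divide_nat: "val_ge p n x \<Longrightarrow> \<not> p dvd b \<Longrightarrow> val_ge p n (x / of_nat b)"
  using val_ge_mult_0[of n x "1 / of_nat b"] val_ge_1_over_nat[of b] by simp

lemma val_ge_of_int_iff: "val_ge p (int n) (of_int a) \<longleftrightarrow> int p ^ n dvd a"
proof
  assume "int p ^ n dvd a"
  then obtain c where "a = int p ^ n * c" by auto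
  thus "val_ge p (int n) (of_int a)"
    using val_ge_mult_0[OF val_ge_p_power[of n] val_ge_of_int[of c]] by simp
next
  assume "val_ge p (int n) (of_int a)"
  then obtain c d where *: "\<not> int p dvd d" "(of_int a :: rat) = of_nat p powi (int n) * (of_int c / of_int d)"
    unfolding val_ge_def by auto
  hence "(of_int a :: rat) * of_int d = of_nat p ^ n * of_int c"
    by (auto simp: field_simps)
  hence "(of_int (a * d) :: rat) = of_int (int p ^ n * c)" by simp
  hence "a * d = int p ^ n * c" by (simp only: of_int_eq_iff)
  hence "int p ^ n dvd a * d" by simp
  moreover have "coprime (int p ^ n) d" using * prime_int_p prime_imp_coprime[of "int p" d] by simp
  ultimately show "int p ^ n dvd a" by (simp add: coprime_dvd_mult_left_iff)
qed

lemma val_ge_of_nat_iff: "val_ge p (int n) (of_nat a) \<longleftrightarrow> p ^ n dvd a"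
  using val_ge_of_int_iff[of n "int a"] by (simp flip: of_nat_power)

lemma val_ge_cong_nat: "[a = b] (mod p ^ n) \<Longrightarrow> val_ge p (int n) (of_nat a - of_nat b)"
proof -
  assume "[a = b] (mod p ^ n)"
  hence "int p ^ n dvd int a - int b"
    by (metis cong_iff_dvd_diff cong_int_iff of_nat_power)
  thus ?thesis using val_ge_of_int_iff[of n "int a - int b"] by simp
qed

text \<open>Multiplying by \<open>b\<close> would make \<open>a\<close> divisible by
  \<open>p\<close>. A factor \<open>p\<close> of \<open>b\<close> only lowers the valuation, so
  explicit harmonic numbers can be tested on their numerators.\<close>

lemma not_val_ge_1_unit: "\<not> p dvd a \<Longrightarrow> b \<noteq> 0 \<Longrightarrow> \<not> val_ge p 1 (of_nat a / of_nat b)"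
proof
  assume *: "\<not> p dvd a" "b \<noteq> 0" "val_ge p 1 (of_nat a / of_nat b)"
  have "val_ge p 1 (of_nat a / of_nat b * of_nat b)" by (intro val_ge_mult_0 * val_ge_of_nat)
  thus False using * val_ge_of_nat_iff[of 1 a] by simp
qed

end

text \<open>A prime factor of the reduced denominator would have to divide the numerator as well.
  This local-global step lets one prime be treated at a time.\<close>

lemma rat_Ints_if_val_ge:
  assumes "\<And>p. prime p \<Longrightarrow> val_ge p 0 (x :: rat)"
  shows "x \<in> \<int>"
proof -
  obtain a b where ab: "quotient_of x = (a, b)" by force
  hence b: "b > 0" "coprime a b" "x = of_int a / of_int b"
    using quotient_of_denom_pos quotient_of_coprime quotient_of_div by auto
  have "b = 1"
  proof (rule ccontr)
    assume "b \<noteq> 1"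
    hence "nat b \<noteq> 1" using b by auto
    then obtain p where p: "prime p" "p dvd nat b" using prime_factor_nat by blast
    interpret prime_nat p using p by unfold_locales
    from assms[OF p(1)] obtain c d where cd: "\<not> int p dvd d" "x = of_int c / of_int d"
      unfolding val_ge_def by auto
    hence "of_int a / of_int b = (of_int c / of_int d :: rat)" using b by simp
    moreover have "d \<noteq> 0" using cd by auto
    ultimately have "(of_int (a * d) :: rat) = of_int (c * b)" using b by (simp add: field_simps)
    hence e: "a * d = c * b" by (simp only: of_int_eq_iff)
    have pb: "int p dvd b" using p b by (metis int_dvd_int_iff nat_0_le less_le)
    hence "int p dvd a * d" using e by simp
    hence "int p dvd a" using cd prime_int_p by (simp add: prime_dvd_mult_iff)
    thus False using pb b(2) prime_int_p by (meson not_coprimeI not_prime_unit)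
  qed
  thus ?thesis using b by simp
qed

context prime_nat begin

lemma padic_val_le_imp_val_ge: "n \<le> padic_val p x \<Longrightarrow> val_ge p n x"
proof -
  assume n: "n \<le> padic_val p x"
  obtain a b where ab: "quotient_of x = (a, b)" by force
  hence b: "b > 0" "coprime a b" "x = of_int a / of_int b"
    using quotient_of_denom_pos quotient_of_coprime quotient_of_div by auto
  show ?thesis
  proof (cases "a = 0")
    \<comment> \<open>At 0 \<open>padic_val\<close> takes the junk value 0, but
      \<open>val_ge\<close> holds there at every level.\<close>
    case True thus ?thesis using b by simp
  next
    case False
    define i j where "i = multiplicity (int p) a" and "j = multiplicity (int p) b"
    obtain a' where a': "a = int p ^ i * a'" "\<not> int p dvd a'"
      using multiplicity_decompose'[of a "int p"] False prime_int_p i_def by (metis not_prime_unit)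
    obtain b' where b': "b = int p ^ j * b'" "\<not> int p dvd b'"
      using multiplicity_decompose'[of b "int p"] b prime_int_p j_def by (metis not_prime_unit less_irrefl)
    have v: "padic_val p x = int i - int j" unfolding padic_val_def ab i_def j_def by simp
    have "x = of_nat p powi (int i - int j) * (of_int a' / of_int b')"
      using b a' b' by (simp add: power_int_diff field_simps)
    hence "val_ge p (int i - int j) x" unfolding val_ge_def using b' by blast
    thus ?thesis using v n val_ge_mono by metis
  qed
qed

end

section \<open>Dwork's integrality criterion for exponentials\<close>

lemma fact_add_prod: "fact (m + n) = (fact m * (\<Prod>i=1..n. m + i) :: nat)"
  by (induction n) (simp_all add: algebra_simps)

definition unit_block :: "nat \<Rightarrow> nat \<Rightarrow> nat" where
  "unit_block p i = (\<Prod>r=1..<p. i * p + r)"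

text \<open>The product of the integers below py that are prime to \<open>p\<close>: up to sign,
  Morita's p-adic gamma function at py.\<close>

definition unit_fact :: "nat \<Rightarrow> nat \<Rightarrow> nat" where
  "unit_fact p y = (\<Prod>i<y. unit_block p i)"

context prime_nat begin

lemma coprime_block_term: "0 < r \<Longrightarrow> r < p \<Longrightarrow> \<not> p dvd i * p + r"
  by (simp add: nat_dvd_not_less)

lemma not_dvd_prod: "(\<And>i. i \<in> I \<Longrightarrow> \<not> p dvd f i) \<Longrightarrow> \<not> p dvd (\<Prod>i\<in>I. f i)"
  by (induction I rule: infinite_finite_induct)
     (use prime_p in \<open>auto simp: prime_dvd_mult_iff\<close>)

lemma not_dvd_power: "\<not> p dvd x \<Longrightarrow> \<not> p dvd x ^ k"
  using prime_p prime_dvd_power by blast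

lemma unit_block_unit: "\<not> p dvd unit_block p i"
  unfolding unit_block_def by (intro not_dvd_prod coprime_block_term) auto

lemma unit_fact_unit: "\<not> p dvd unit_fact p y"
  unfolding unit_fact_def by (intro not_dvd_prod unit_block_unit)

lemma fact_mult_p: "fact (p * y) = p ^ y * fact y * unit_fact p y"
proof (induction y)
  case (Suc y)
  have "fact (p * Suc y) = (fact (p * y + p) :: nat)" by (simp add: algebra_simps)
  also have "\<dots> = fact (p * y) * (\<Prod>i=1..p. p * y + i)" by (rule fact_add_prod)
  also have "{1..p} = insert p {1..<p}" using p_gt_1 by auto
  also have "(\<Prod>i\<in>insert p {1..<p}. p * y + i) = (p * y + p) * unit_block p y"
    unfolding unit_block_def by (subst prod.insert) (simp_all add: mult.commute)
  finally show ?case using Suc.IH by (simp add: unit_fact_def algebra_simps)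
qed (simp add: unit_fact_def)

lemma fact_split_p:
  assumes "v < p"
  shows "fact (v + p * y) = fact (p * y) * (\<Prod>i=1..v. p * y + i)"
    and "\<not> p dvd (\<Prod>i=1..v. p * y + i)"
  using fact_add_prod[of "p * y" v] coprime_block_term[of _ y] assms
  by (auto simp: add.commute mult.commute intro!: not_dvd_prod)

text \<open>This is v_p(n!) <= n - 1. Writing n = v + pq gives n! = p^q q! U with a unit U, and 2q
  <= n turns the bound for q into the bound for n.\<close>

lemma val_ge_p_power_over_fact: "n \<ge> 1 \<Longrightarrow> val_ge p 0 (of_nat p ^ (n - 1) / fact n)"
proof (induction n rule: less_induct)
  case (less n)
  define q v where "q = n div p" and "v = n mod p"
  have n: "n = v + p * q" and v: "v < p" using p_gt_1 by (auto simp: q_def v_def)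
  define U where "U = unit_fact p q * (\<Prod>i=1..v. p * q + i)"
  have U: "\<not> p dvd U" unfolding U_def using unit_fact_unit fact_split_p(2)[OF v] prime_p
    by (simp add: prime_dvd_mult_iff)
  have "(fact n :: nat) = p ^ q * fact q * U"
    unfolding n using fact_split_p(1)[OF v, of q] by (simp add: U_def fact_mult_p)
  hence f: "(fact n :: rat) = of_nat p ^ q * fact q * of_nat U"
    by (metis of_nat_fact of_nat_mult of_nat_power)
  have nz: "U \<noteq> 0" using U by (metis dvd_0_right)
  show ?case
  proof (cases "q = 0")
    case True
    thus ?thesis using f val_ge_mult_0[OF val_ge_of_nat val_ge_1_over_nat[OF U], of "p ^ (n - 1)"]
      by simp
  next
    case False
    have q: "q < n" using less.prems p_gt_1 by (simp add: q_def)
    have "p * q \<ge> 2 * q" using p_gt_1 by simp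
    hence "n - 1 = q + (q - 1) + (n - 2 * q)" using n False by linarith
    hence "(of_nat p :: rat) ^ (n - 1) = of_nat p ^ q * of_nat p ^ (q - 1) * of_nat p ^ (n - 2 * q)"
      by (simp only: power_add)
    hence "of_nat p ^ (n - 1) / fact n =
        of_nat p ^ (q - 1) / fact q * of_nat (p ^ (n - 2 * q)) * (1 / (of_nat U :: rat))"
      using f nz by simp
    also have "val_ge p 0 \<dots>"
      by (intro val_ge_0_mult less.IH[OF q] val_ge_of_nat val_ge_1_over_nat U) (use False in simp)
    finally show ?thesis .
  qed
qed

section \<open>Divisibility of power series and the Frobenius congruence\<close>

definition fps_ge :: "int \<Rightarrow> rat fps \<Rightarrow> bool" where
  "fps_ge n f \<longleftrightarrow> (\<forall>i. val_ge p n (f $ i))"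

lemma fps_ge_mult: "fps_ge n f \<Longrightarrow> fps_ge m g \<Longrightarrow> fps_ge (n + m) (f * g)"
  unfolding fps_ge_def by (auto simp: fps_mult_nth intro!: val_ge_sum val_ge_mult)

lemma fps_ge_mult_0: "fps_ge n f \<Longrightarrow> fps_ge 0 g \<Longrightarrow> fps_ge n (f * g)"
  using fps_ge_mult[of n f 0 g] by simp

lemma fps_ge_0_mult: "fps_ge 0 f \<Longrightarrow> fps_ge n g \<Longrightarrow> fps_ge n (f * g)"
  using fps_ge_mult[of 0 f n g] by simp

lemma fps_ge_add: "fps_ge n f \<Longrightarrow> fps_ge n g \<Longrightarrow> fps_ge n (f + g)"
  unfolding fps_ge_def by (auto intro: val_ge_add)

lemma fps_ge_sum: "(\<And>i. i \<in> I \<Longrightarrow> fps_ge n (f i)) \<Longrightarrow> fps_ge n (\<Sum>i\<in>I. f i)"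
  unfolding fps_ge_def by (auto simp: fps_sum_nth intro: val_ge_sum)

lemma fps_ge_const: "val_ge p n c \<Longrightarrow> fps_ge n (fps_const c)"
  unfolding fps_ge_def by auto

lemma fps_ge_1: "fps_ge 0 1"
  unfolding fps_ge_def by auto

lemma fps_ge_power: "fps_ge n f \<Longrightarrow> fps_ge (int k * n) (f ^ k)"
proof (induction k)
  case (Suc k)
  thus ?case using fps_ge_mult[of n f "int k * n" "f ^ k"] by (simp add: algebra_simps)
qed (use fps_ge_1 in simp)

lemma fps_ge_power_0: "fps_ge 0 f \<Longrightarrow> fps_ge 0 (f ^ k)"
  using fps_ge_power[of 0 f k] by simp

lemma fps_ge_X_power: "fps_ge 0 (fps_X ^ k)"
  unfolding fps_ge_def by simp

lemma p_dvd_choose: "k \<in> {1..<p} \<Longrightarrow> p dvd (p choose k)"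
  using prime_p by (intro dvd_choose_prime) auto

lemma freshman:
  assumes "fps_ge 0 f" "fps_ge 0 g"
  shows "fps_ge 1 ((f + g) ^ p - f ^ p - g ^ p)"
proof -
  have "{..p} = insert 0 (insert p {1..<p})" using p_gt_1 by auto
  hence "(f + g) ^ p = g ^ p + f ^ p + (\<Sum>k\<in>{1..<p}. of_nat (p choose k) * f ^ k * g ^ (p - k))"
    using binomial_ring[of f g p] p_gt_1 by (simp add: add.assoc)
  hence "(f + g) ^ p - f ^ p - g ^ p =
      (\<Sum>k\<in>{1..<p}. fps_const (of_nat (p choose k)) * f ^ k * g ^ (p - k))"
    by (simp add: fps_of_nat)
  moreover have "val_ge p 1 (of_nat (p choose k))" if "k \<in> {1..<p}" for k
    using val_ge_of_nat_iff[of 1 "p choose k"] p_dvd_choose[OF that] by simp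
  ultimately show ?thesis using assms
    by (auto intro!: fps_ge_sum fps_ge_mult_0 fps_ge_const fps_ge_power_0)
qed

lemma int_fermat: "int p dvd a ^ p - a"
proof -
  have *: "int p dvd int n ^ p - int n" for n
  proof (induction n)
    case (Suc n)
    have "{..p} = insert 0 (insert p {1..<p})" using p_gt_1 by auto
    hence "(int n + 1) ^ p = 1 + int n ^ p + (\<Sum>k\<in>{1..<p}. of_nat (p choose k) * int n ^ k)"
      using binomial_ring[of "int n" 1 p] p_gt_1 by (simp add: add.assoc)
    moreover have "int p dvd (\<Sum>k\<in>{1..<p}. of_nat (p choose k) * int n ^ k)"
      using p_dvd_choose by (intro dvd_sum dvd_mult2) simp
    ultimately have "int p dvd ((int n + 1) ^ p - (int n + 1)) - (int n ^ p - int n)" by simp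
    thus ?case using Suc by (metis dvd_diff_commute dvd_diffD1 of_nat_Suc add.commute dvd_add_right_iff diff_add_cancel)
  qed (use p_gt_1 in \<open>simp add: power_0_left\<close>)
  have "[int (nat (a mod int p)) = a] (mod int p)" using p_gt_1 by (simp add: cong_def)
  hence "[int (nat (a mod int p)) ^ p - int (nat (a mod int p)) = a ^ p - a] (mod int p)"
    by (intro cong_diff cong_pow)
  thus ?thesis using * cong_dvd_iff by blast
qed

text \<open>For x = a/b the numerator a^p b - a b^p equals (a^p - a) b - a (b^p - b), which reduces
  the claim to integers.\<close>

lemma rat_fermat: "val_ge p 0 x \<Longrightarrow> val_ge p 1 (x ^ p - x)"
proof -
  assume "val_ge p 0 x"
  then obtain a b where ab: "\<not> int p dvd b" "x = of_int a / of_int b"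
    unfolding val_ge_def by auto
  have b: "b \<noteq> 0" using ab by auto
  have "a ^ p * b - a * b ^ p = (a ^ p - a) * b - a * (b ^ p - b)" by (simp add: algebra_simps)
  hence "int p dvd a ^ p * b - a * b ^ p" using int_fermat by simp
  hence 1: "val_ge p 1 (of_int (a ^ p * b - a * b ^ p))"
    using val_ge_of_int_iff[of 1] by (simp del: of_int_diff of_int_mult of_int_power)
  have "\<not> int p dvd b ^ p * b" using ab prime_int_p
    by (metis prime_dvd_mult_iff prime_dvd_power)
  hence "val_ge p 1 (of_int (a ^ p * b - a * b ^ p) * (1 / of_int (b ^ p * b)))"
    by (intro val_ge_mult_0 1 val_ge_1_over_int)
  also have "of_int (a ^ p * b - a * b ^ p) * (1 / of_int (b ^ p * b)) = x ^ p - x"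
    using b unfolding ab(2) by (simp add: field_simps)
  finally show ?thesis .
qed

lemma fps_compose_X_power_nth:
  "k > 0 \<Longrightarrow> (f oo fps_X ^ k) $ n = (if k dvd n then f $ (n div k) else (0 :: 'a :: comm_ring_1))"
proof -
  assume k: "k > 0"
  have "(f oo fps_X ^ k) $ n = (\<Sum>i=0..n. f $ i * (if n = k * i then 1 else 0))"
    by (simp add: fps_compose_nth flip: power_mult)
  also have "\<dots> = (\<Sum>i=0..n. if i = n div k \<and> k dvd n then f $ i else 0)"
    using k by (intro sum.cong) auto
  also have "\<dots> = (if k dvd n then f $ (n div k) else 0)"
    by (cases "k dvd n") auto
  finally show ?thesis .
qed

text \<open>The congruence of f(z)^p and f(z^p) modulo p, built up one monomial at a time from
  Fermat's congruence for the coefficient. Truncations are used because the later induction knows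
  integrality only below \<open>n\<close>.\<close>

lemma frobenius_cutoff:
  assumes "\<And>i. i < n \<Longrightarrow> val_ge p 0 (f $ i)"
  shows "fps_ge 0 (fps_cutoff n f) \<and> fps_ge 1 (fps_cutoff n f ^ p - (fps_cutoff n f oo fps_X ^ p))"
  using assms
proof (induction n)
  case 0
  show ?case using p_gt_1 by (simp add: fps_ge_def power_0_left)
next
  case (Suc n)
  define T where "T = fps_cutoff n f"
  define u where "u = fps_const (f $ n) * fps_X ^ n"
  have T: "fps_ge 0 T" "fps_ge 1 (T ^ p - (T oo fps_X ^ p))" using Suc by (auto simp: T_def)
  have eq: "fps_cutoff (Suc n) f = T + u"
    by (auto simp: fps_eq_iff T_def u_def fps_X_power_iff less_Suc_eq)
  have v: "val_ge p 0 (f $ n)" using Suc.prems by simp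
  have u: "fps_ge 0 u" unfolding u_def by (intro fps_ge_mult_0 fps_ge_const v fps_ge_X_power)
  have X0: "(fps_X ^ p :: rat fps) $ 0 = 0" using p_gt_1 by simp
  have "u oo fps_X ^ p = fps_const (f $ n) * fps_X ^ (p * n)"
    unfolding u_def using X0 p_gt_1
    by (simp add: fps_compose_mult_distrib flip: fps_compose_power power_mult)
  moreover have "u ^ p = fps_const ((f $ n) ^ p) * fps_X ^ (p * n)"
    unfolding u_def by (simp add: power_mult_distrib fps_const_power mult.commute flip: power_mult)
  ultimately have "u ^ p - (u oo fps_X ^ p) = fps_const ((f $ n) ^ p - f $ n) * fps_X ^ (p * n)"
    by (simp add: left_diff_distrib flip: fps_const_sub)
  hence "fps_ge 1 (u ^ p - (u oo fps_X ^ p))"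
    by (auto intro!: fps_ge_mult_0 fps_ge_const fps_ge_X_power rat_fermat v)
  hence "fps_ge 1 (((T + u) ^ p - T ^ p - u ^ p) + (T ^ p - (T oo fps_X ^ p)) + (u ^ p - (u oo fps_X ^ p)))"
    by (intro fps_ge_add freshman T u)
  hence "fps_ge 1 ((T + u) ^ p - ((T + u) oo fps_X ^ p))"
    by (simp add: fps_compose_add_distrib algebra_simps)
  thus ?case unfolding eq using T u fps_ge_add by blast
qed

end

section \<open>The formal exponential and rational powers\<close>

lemma fps_exp_compose_add:
  fixes g h :: "rat fps"
  assumes "g $ 0 = 0" "h $ 0 = 0"
  shows "fps_exp 1 oo (g + h) = (fps_exp 1 oo g) * (fps_exp 1 oo h)"
proof -
  define E where "E = (\<lambda>g :: rat fps. fps_exp 1 oo g)"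
  have d: "fps_deriv (E g) = E g * fps_deriv g" if "g $ 0 = 0" for g
    unfolding E_def using fps_compose_deriv[OF that, of "fps_exp 1"] by simp
  have E0: "E g $ 0 = 1" for g by (simp add: E_def)
  have s: "(g + h) $ 0 = 0" using assms by simp
  \<comment> \<open>The quotient of the two sides has derivative 0 and constant term 1, so it equals
    1.\<close>
  define D where "D = E g * E h * inverse (E (g + h))"
  define I where "I = inverse (E (g + h))"
  have I: "E (g + h) * I = 1" using E0[of "g + h"] by (simp add: I_def inverse_mult_eq_1')
  have "fps_deriv I = - ((fps_deriv g + fps_deriv h) * (E (g + h) * I) * I)"
    using E0[of "g + h"] by (simp add: I_def d[OF s] fps_inverse_deriv power2_eq_square mult_ac)
  hence I': "fps_deriv I = - ((fps_deriv g + fps_deriv h) * I)" by (simp add: I)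
  have "fps_deriv D = 0" unfolding D_def I_def[symmetric]
    by (simp add: d assms I' algebra_simps)
  hence "D = 1" unfolding fps_deriv_eq_0_iff by (simp add: D_def E0)
  hence "E g * E h * (inverse (E (g + h)) * E (g + h)) = E (g + h)"
    by (simp add: D_def mult.assoc[symmetric])
  thus ?thesis using E0[of "g + h"] by (simp add: inverse_mult_eq_1 E_def)
qed

lemma fps_exp_compose_of_nat_mult:
  fixes g :: "rat fps"
  assumes "g $ 0 = 0"
  shows "fps_exp 1 oo (of_nat m * g) = (fps_exp 1 oo g) ^ m"
proof (induction m)
  case (Suc m)
  have "fps_exp 1 oo (of_nat (Suc m) * g) = fps_exp 1 oo (g + of_nat m * g)" by (simp add: algebra_simps)
  also have "\<dots> = (fps_exp 1 oo g) * (fps_exp 1 oo (of_nat m * g))"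
    using assms by (intro fps_exp_compose_add) auto
  finally show ?case by (simp add: Suc)
qed simp

text \<open>\<open>fps_ln 1\<close> is the compositional inverse of exp(X) - 1, so a rational power
  of q becomes the exponential of a multiple of G/F.\<close>

lemma fps_rat_power_exp:
  assumes "g $ 0 = 0"
  shows "fps_rat_power (fps_exp 1 oo g) c = fps_exp 1 oo (fps_const c * g)"
proof -
  define e where "e = fps_exp (1::rat) - 1"
  have e0: "e $ 0 = 0" "e $ 1 \<noteq> 0" by (simp_all add: e_def)
  have "fps_ln 1 oo ((fps_exp 1 oo g) - 1) = fps_ln 1 oo (e oo g)"
    by (simp add: e_def fps_compose_sub_distrib)
  also have "\<dots> = (fps_ln 1 oo e) oo g" using assms e0 by (intro fps_compose_assoc) auto
  also have "fps_ln 1 oo e = fps_X"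
    using fps_ln_fps_exp_inv[of "1::rat"] fps_inv[OF e0] by (simp add: e_def)
  also have "fps_X oo g = g" using assms by simp
  finally show ?thesis by (simp add: fps_rat_power_def)
qed

text \<open>First-order expansion: since n >= 1, terms quadratic in z^n s and the non-constant terms
  of \<open>T\<close> act only above order n.\<close>

lemma one_plus_X_power_mult_power:
  fixes T s :: "'a :: comm_ring_1 fps"
  assumes "T $ 0 = 1" "n \<ge> 1"
  shows "\<exists>w. (T + fps_X ^ n * s) ^ m = T ^ m + fps_X ^ n * w \<and> w $ 0 = of_nat m * s $ 0"
proof (induction m)
  case (Suc m)
  then obtain w where w: "(T + fps_X ^ n * s) ^ m = T ^ m + fps_X ^ n * w" "w $ 0 = of_nat m * s $ 0"
    by blast
  have "(T + fps_X ^ n * s) ^ Suc m =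
      T ^ Suc m + fps_X ^ n * (T * w + s * T ^ m + fps_X ^ n * (w * s))"
    using w by (simp add: algebra_simps)
  moreover have "(T * w + s * T ^ m + fps_X ^ n * (w * s)) $ 0 = of_nat (Suc m) * s $ 0"
    using w assms by (simp add: algebra_simps fps_power_zeroth power_0_left)
  ultimately show ?case by blast
qed (auto intro!: exI[of _ 0])

context prime_nat begin

text \<open>The term h^i / i! has valuation at least i - (i - 1) = 1, also for p = 2.\<close>

lemma fps_exp_compose_small:
  assumes "h $ 0 = 0" "fps_ge 1 h"
  shows "fps_ge 1 ((fps_exp 1 oo h) - 1)"
  unfolding fps_ge_def
proof
  fix n
  have "val_ge p 1 (fps_exp 1 $ i * h ^ i $ n)" if "i \<ge> 1" for i
  proof -
    have "fps_ge (int i) (h ^ i)" using fps_ge_power[OF assms(2), of i] by simp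
    hence "val_ge p (1 + int (i - 1)) (h ^ i $ n)" using that by (simp add: fps_ge_def of_nat_diff)
    hence "val_ge p 1 (h ^ i $ n / of_nat p powi int (i - 1))" by (rule val_ge_divide_p_powi)
    hence "val_ge p 1 (h ^ i $ n / of_nat p ^ (i - 1) * (of_nat p ^ (i - 1) / fact i))"
      using val_ge_p_power_over_fact[OF that] by (intro val_ge_mult_0) simp_all
    thus ?thesis by simp
  qed
  hence "val_ge p 1 (\<Sum>i=1..n. fps_exp 1 $ i * h ^ i $ n)" by (intro val_ge_sum) auto
  also have "(\<Sum>i=1..n. fps_exp 1 $ i * h ^ i $ n) = ((fps_exp 1 oo h) - 1) $ n"
    by (simp add: fps_compose_nth sum.atLeast_Suc_atMost)
  finally show "val_ge p 1 (((fps_exp 1 oo h) - 1) $ n)" .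
qed

text \<open>Comparing coefficients of \<open>z\<^sup>n\<close> in \<open>f(z\<^sup>p) = f(z)\<^sup>p exp(h)\<close> isolates \<open>p f\<^sub>n\<close>, and the
  remaining terms are divisible by \<open>p\<close> by the Frobenius congruence for truncations.\<close>
theorem dwork_fps_exp:
  assumes g0: "g $ 0 = 0" and g: "fps_ge 1 ((g oo fps_X ^ p) - of_nat p * g)"
  shows "fps_ge 0 (fps_exp 1 oo g)"
proof -
  define f where "f = fps_exp 1 oo g"
  define h where "h = (g oo fps_X ^ p) - of_nat p * g"
  define D where "D = (fps_exp 1 oo h) - 1"
  have X0: "(fps_X ^ p :: rat fps) $ 0 = 0" using p_gt_1 by simp
  have h0: "h $ 0 = 0" using g0 by (simp add: h_def)
  have D: "fps_ge 1 D" unfolding D_def by (rule fps_exp_compose_small) (use h0 g h_def in auto)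
  have D0: "D $ 0 = 0" by (simp add: D_def)
  have "f oo fps_X ^ p = fps_exp 1 oo (of_nat p * g + h)"
    unfolding f_def h_def using fps_compose_assoc[OF X0 g0, of "fps_exp 1"] by simp
  also have "\<dots> = f ^ p * (1 + D)"
    using g0 h0 by (subst fps_exp_compose_add)
      (simp_all add: fps_exp_compose_of_nat_mult f_def D_def)
  finally have key: "f oo fps_X ^ p = f ^ p * (1 + D)" .
  have f0: "f $ 0 = 1" by (simp add: f_def)
  have "val_ge p 0 (f $ n)" for n
  proof (induction n rule: less_induct)
    case (less n)
    show ?case
    proof (cases "n = 0")
      case False
      define T s where "T = fps_cutoff n f" and "s = fps_shift n f"
      have fTs: "f = T + fps_X ^ n * s" unfolding T_def s_def
        using fps_shift_cutoff'[of n f] by (simp add: add.commute)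
      have T0: "T $ 0 = 1" using False f0 by (simp add: T_def)
      obtain w where w: "f ^ p = T ^ p + fps_X ^ n * w" "w $ 0 = of_nat p * s $ 0"
        using one_plus_X_power_mult_power[OF T0, of n s p] False fTs by auto
      have T: "fps_ge 0 T" "fps_ge 1 (T ^ p - (T oo fps_X ^ p))"
        using frobenius_cutoff[of n f] less by (auto simp: T_def)
      \<comment> \<open>The composition involves only the coefficient of index n/p, which lies below
        n, so the truncation may replace \<open>f\<close>.\<close>
      have "(f oo fps_X ^ p) $ n = (T oo fps_X ^ p) $ n"
        using False p_gt_1 by (simp add: fps_compose_X_power_nth T_def)
      moreover have "(f ^ p * (1 + D)) $ n = (T ^ p) $ n + (T ^ p * D) $ n + (fps_X ^ n * (w * (1 + D))) $ n"
        unfolding w by (simp add: algebra_simps)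
      moreover have "(fps_X ^ n * (w * (1 + D))) $ n = of_nat p * f $ n"
        using w D0 by (simp add: fps_X_power_mult_nth s_def)
      ultimately have "of_nat p * f $ n = - ((T ^ p - (T oo fps_X ^ p)) $ n) - (T ^ p * D) $ n"
        using key by simp
      also have "val_ge p 1 \<dots>"
        using T(2) fps_ge_0_mult[OF fps_ge_power_0[OF T(1)] D, of p]
        unfolding fps_ge_def by (intro val_ge_diff) (simp_all only: val_ge_minus)
      finally show ?thesis by (simp add: val_ge_p_times)
    qed (simp add: f0)
  qed
  thus ?thesis by (simp add: fps_ge_def f_def)
qed

end

section \<open>Dwork congruences\<close>

lemma sum_blocks:
  fixes f :: "nat \<Rightarrow> 'a :: comm_monoid_add"
  shows "sum f {c * k..<(c + q) * k} = (\<Sum>i<q. sum f {(c + i) * k..<(c + i) * k + k})"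
proof (induction q)
  case (Suc q)
  have "sum f {c * k..<(c + Suc q) * k} =
      sum f {c * k..<(c + q) * k} + sum f {(c + q) * k..<(c + Suc q) * k}"
    by (intro sum.atLeastLessThan_concat[symmetric]) auto
  also have "\<dots> = (\<Sum>i<Suc q. sum f {(c + i) * k..<(c + i) * k + k})"
    using Suc by (simp add: add.commute)
  finally show ?case .
qed simp

text \<open>Hypotheses for Dwork's congruences: \<open>\<rho> v y\<close> is the ratio of
  \<open>A (v + p * y)\<close> to \<open>A y\<close>, and it depends p-adically continuously on
  \<open>y\<close>.\<close>

locale dwork_sequence = prime_nat +
  fixes A :: "nat \<Rightarrow> rat" and \<rho> :: "nat \<Rightarrow> nat \<Rightarrow> rat"
  assumes A_0: "A 0 = 1"
    and A_nonzero: "A n \<noteq> 0"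
    and A_step: "v < p \<Longrightarrow> A (v + p * y) = A y * \<rho> v y"
    and \<rho>_integral: "v < p \<Longrightarrow> val_ge p 0 (\<rho> v y)"
    and \<rho>_cong: "v < p \<Longrightarrow> val_ge p (int s + 1) (\<rho> v (u + n * p ^ s) - \<rho> v u)"
begin

lemma A_integral: "val_ge p 0 (A n)"
proof (induction n rule: less_induct)
  case (less n)
  show ?case
  proof (cases "n = 0")
    case False
    have "A n = A (n div p) * \<rho> (n mod p) (n div p)"
      using A_step[of "n mod p" "n div p"] p_gt_1 by simp
    thus ?thesis using less[of "n div p"] False p_gt_1 \<rho>_integral by (simp add: val_ge_0_mult)
  qed (simp add: A_0)
qed

text \<open>Stripping the \<open>s\<close> lowest base p digits one at a time gives an integral
  factor \<open>\<rho>\<close> for each and leaves \<open>A n\<close>.\<close>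

lemma A_quotient_integral: "u < p ^ s \<Longrightarrow> val_ge p 0 (A (u + n * p ^ s) / A n)"
proof (induction s arbitrary: u)
  case (Suc s)
  define v y where "v = u mod p" and "y = u div p"
  have u: "u = v + p * y" and v: "v < p" using p_gt_1 by (simp_all add: v_def y_def)
  have "y < p ^ s" using Suc.prems p_gt_1 by (simp add: y_def less_mult_imp_div_less mult.commute)
  moreover have "u + n * p ^ Suc s = v + p * (y + n * p ^ s)" by (simp add: u algebra_simps)
  hence "A (u + n * p ^ Suc s) / A n = A (y + n * p ^ s) / A n * \<rho> v (y + n * p ^ s)"
    using A_step[OF v] by simp
  ultimately show ?case using Suc.IH \<rho>_integral[OF v] val_ge_0_mult by metis
qed (simp add: A_nonzero)

text \<open>The ratios compared here are \<open>\<rho> v\<close> at u + n p^s and at u; their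
  difference is multiplied by an integral quotient.\<close>

lemma A_cong:
  assumes v: "v < p" and u: "u < p ^ s"
  shows "val_ge p (int s + 1)
    ((A (v + p * u + n * p ^ Suc s) - A (v + p * u) * (A (u + n * p ^ s) / A u)) / A n)"
proof -
  have "v + p * u + n * p ^ Suc s = v + p * (u + n * p ^ s)" by (simp add: algebra_simps)
  hence "(A (v + p * u + n * p ^ Suc s) - A (v + p * u) * (A (u + n * p ^ s) / A u)) / A n =
      (\<rho> v (u + n * p ^ s) - \<rho> v u) * (A (u + n * p ^ s) / A n)"
    using A_nonzero by (simp only: A_step[OF v]) (simp add: field_simps)
  thus ?thesis using \<rho>_cong[OF v] A_quotient_integral[OF u] val_ge_mult_0 by metis
qed

context
  fixes a :: nat
  assumes a_less: "a < p"
begin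

text \<open>Dwork's bracket for the coefficient of index a + pK, extended by 0 beyond
  \<open>K\<close> so that sums may run over complete base p blocks.\<close>

definition T :: "nat \<Rightarrow> nat \<Rightarrow> rat" where
  "T K j = (if j \<le> K then A (a + p * j) * A (K - j) - A j * A (a + p * (K - j)) else 0)"

definition S :: "nat \<Rightarrow> nat \<Rightarrow> nat \<Rightarrow> rat" where
  "S K s m = sum (T K) {m * p ^ s..<m * p ^ s + p ^ s}"

lemma S_0: "S K 0 m = T K m" by (simp add: S_def)

lemma S_eq_0: "K < m * p ^ s \<Longrightarrow> S K s m = 0"
  unfolding S_def by (intro sum.neutral) (auto simp: T_def)

lemma S_Suc: "S K (Suc s) m = (\<Sum>i<p. S K s (i + p * m))"
  using sum_blocks[of "T K" "p * m" "p ^ s" p] unfolding S_def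
  by (simp add: algebra_simps)

text \<open>The bracket changes sign under the reflection of j to K - j.\<close>

lemma sum_T_eq_0:
  assumes "K < L"
  shows "sum (T K) {..<L} = 0"
proof -
  have "sum (T K) {..<L} = sum (T K) {..K}"
    using assms by (intro sum.mono_neutral_right) (auto simp: T_def)
  also have "\<dots> = (\<Sum>j\<le>K. A (a + p * j) * A (K - j)) - (\<Sum>j\<le>K. A j * A (a + p * (K - j)))"
    by (simp add: T_def sum_subtractf)
  also have "(\<Sum>j\<le>K. A j * A (a + p * (K - j))) = (\<Sum>j\<le>K. A (K - j) * A (a + p * (K - (K - j))))"
    using sum.nat_diff_reindex[of "\<lambda>j. A j * A (a + p * (K - j))" "Suc K"]
    by (simp add: lessThan_Suc_atMost)
  also have "\<dots> = (\<Sum>j\<le>K. A (a + p * j) * A (K - j))"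
    by (intro sum.cong) auto
  finally show ?thesis by simp
qed

lemma sum_S_eq_0:
  assumes "K < M * p ^ s"
  shows "(\<Sum>m<M. S K s m) = 0"
  using sum_T_eq_0[OF assms] sum_blocks[of "T K" 0 "p ^ s" M]
  by (simp add: S_def lessThan_atLeast0)

text \<open>In each term the products containing \<open>A (a + p * (K - j))\<close> cancel exactly,
  and \<open>A_cong\<close> bounds what is left.\<close>

lemma S_shift_0:
  "val_ge p (int s + 1)
    ((S (K + m * p ^ s) s m - (\<Sum>j<p ^ s. A (j + m * p ^ s) / A j * S K 0 j)) / A m)"
proof -
  have "S (K + m * p ^ s) s m = (\<Sum>j<p ^ s. T (K + m * p ^ s) (j + m * p ^ s))"
    using sum.shift_bounds_nat_ivl[of "T (K + m * p ^ s)" 0 "m * p ^ s" "p ^ s"]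
    by (simp add: S_def lessThan_atLeast0 add.commute)
  hence "(S (K + m * p ^ s) s m - (\<Sum>j<p ^ s. A (j + m * p ^ s) / A j * S K 0 j)) / A m =
     (\<Sum>j<p ^ s. (T (K + m * p ^ s) (j + m * p ^ s) - A (j + m * p ^ s) / A j * T K j) / A m)"
    by (simp only: S_0 flip: sum_subtractf sum_divide_distrib)
  also have "val_ge p (int s + 1) \<dots>"
  proof (intro val_ge_sum)
    fix j assume "j \<in> {..<p ^ s}"
    hence j: "j < p ^ s" by simp
    show "val_ge p (int s + 1) ((T (K + m * p ^ s) (j + m * p ^ s) - A (j + m * p ^ s) / A j * T K j) / A m)"
    proof (cases "j \<le> K")
      case True
      have "a + p * (j + m * p ^ s) = a + p * j + m * p ^ Suc s" by (simp add: algebra_simps)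
      hence "(T (K + m * p ^ s) (j + m * p ^ s) - A (j + m * p ^ s) / A j * T K j) / A m =
        (A (a + p * j + m * p ^ Suc s) - A (a + p * j) * (A (j + m * p ^ s) / A j)) / A m * A (K - j)"
        using True A_nonzero by (simp add: T_def field_simps)
      thus ?thesis using A_cong[OF a_less j, of m] A_integral val_ge_mult_0 by metis
    qed (simp add: T_def)
  qed
  finally show ?thesis .
qed

text \<open>Blocks are merged in groups of \<open>p\<close>. Replacing the ratio at i + pu by the
  one at u costs r + 1 powers of \<open>p\<close>, the known block congruence supplies t + 1 more,
  and together these are s + 1.\<close>

lemma S_shift_Suc:
  assumes S: "\<And>K m. val_ge p (int t + 1) (S K t m / A m)"
    and shift: "val_ge p (int s + 1)
      ((S (K + m * p ^ s) s m - (\<Sum>j<p ^ Suc r. A (j + m * p ^ Suc r) / A j * S K t j)) / A m)"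
    and s: "s = t + Suc r"
  shows "val_ge p (int s + 1)
      ((S (K + m * p ^ s) s m - (\<Sum>j<p ^ r. A (j + m * p ^ r) / A j * S K (Suc t) j)) / A m)"
proof -
  have "(\<Sum>j<p ^ Suc r. A (j + m * p ^ Suc r) / A j * S K t j) =
      (\<Sum>u<p ^ r. \<Sum>i<p. A (i + p * u + m * p ^ Suc r) / A (i + p * u) * S K t (i + p * u))"
    using sum.nat_group[of "\<lambda>j. A (j + m * p ^ Suc r) / A j * S K t j" p "p ^ r"]
      sum.shift_bounds_nat_ivl[of "\<lambda>j. A (j + m * p ^ Suc r) / A j * S K t j" 0 "_ * p" p]
    by (simp add: lessThan_atLeast0 algebra_simps)
  hence "((\<Sum>j<p ^ Suc r. A (j + m * p ^ Suc r) / A j * S K t j)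
        - (\<Sum>j<p ^ r. A (j + m * p ^ r) / A j * S K (Suc t) j)) / A m =
      (\<Sum>u<p ^ r. \<Sum>i<p. (A (i + p * u + m * p ^ Suc r) / A (i + p * u) * S K t (i + p * u)
        - A (u + m * p ^ r) / A u * S K t (i + p * u)) / A m)"
    by (simp only: S_Suc sum_distrib_left flip: sum_subtractf sum_divide_distrib)
  also have "val_ge p (int s + 1) \<dots>"
  proof (intro val_ge_sum)
    fix u i assume "u \<in> {..<p ^ r}" "i \<in> {..<p}"
    hence ui: "u < p ^ r" "i < p" by auto
    have "(A (i + p * u + m * p ^ Suc r) / A (i + p * u) * S K t (i + p * u)
        - A (u + m * p ^ r) / A u * S K t (i + p * u)) / A m =
      (A (i + p * u + m * p ^ Suc r) - A (i + p * u) * (A (u + m * p ^ r) / A u)) / A m *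
      (S K t (i + p * u) / A (i + p * u))"
      using A_nonzero by (simp add: field_simps)
    moreover have "val_ge p ((int r + 1) + (int t + 1)) \<dots>"
      by (intro val_ge_mult A_cong ui S)
    ultimately show "val_ge p (int s + 1)
       ((A (i + p * u + m * p ^ Suc r) / A (i + p * u) * S K t (i + p * u)
        - A (u + m * p ^ r) / A u * S K t (i + p * u)) / A m)"
      using s by (simp only: of_nat_add of_nat_Suc add_ac)
  qed
  finally have "val_ge p (int s + 1) (((\<Sum>j<p ^ Suc r. A (j + m * p ^ Suc r) / A j * S K t j)
        - (\<Sum>j<p ^ r. A (j + m * p ^ r) / A j * S K (Suc t) j)) / A m)" .
  from val_ge_add[OF shift this] show ?thesis
    by (simp add: diff_divide_distrib)
qed

text \<open>Once the congruence is known at all levels below \<open>s\<close>, it reduces by the shift relations to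
  \<open>m = 0\<close>. There one argues by induction on \<open>K\<close>: the sums \<open>S K s m\<close> over all \<open>m\<close>
  add up to zero, and those with \<open>m \<ge> 1\<close> come from smaller \<open>K\<close>.\<close>
theorem dwork_congruence: "val_ge p (int s + 1) (S K s m / A m)"
proof (induction s arbitrary: K m rule: less_induct)
  case (less s)
  have shift: "val_ge p (int s + 1)
      ((S (K + m * p ^ s) s m - (\<Sum>j<p ^ (s - t). A (j + m * p ^ (s - t)) / A j * S K t j)) / A m)"
    if "t \<le> s" for t K m
    using that
  proof (induction t)
    case 0
    show ?case using S_shift_0 by simp
  next
    case (Suc t)
    hence st: "s - t = Suc (s - Suc t)" by simp
    show ?case
      by (rule S_shift_Suc[OF less]) (use Suc st in auto)
  qed
  \<comment> \<open>At t = s only j = 0 is left, with factor A m / A 0 = A m, so after division by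
    \<open>A m\<close> the subtracted sum is \<open>S K s 0\<close>.\<close>
  have shift_s: "val_ge p (int s + 1) (S (K + m * p ^ s) s m / A m - S K s 0)" for K m
    using shift[of s K m] A_nonzero[of m] by (simp add: A_0 diff_divide_distrib)
  have zero: "val_ge p (int s + 1) (S K s 0)" for K
  proof (induction K rule: less_induct)
    case (less K)
    have "val_ge p (int s + 1) (S K s m)" if "m \<ge> 1" for m
    proof (cases "K < m * p ^ s")
      case False
      define K' where "K' = K - m * p ^ s"
      have K: "K = K' + m * p ^ s" using False by (simp add: K'_def)
      have "m * p ^ s > 0" using that p_gt_1 by simp
      hence "K' < K" using K by linarith
      hence "val_ge p (int s + 1) (S K' s 0)" by (rule less)
      from val_ge_mult_0[OF val_ge_add[OF shift_s[of K' m] this] A_integral[of m]]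
      show ?thesis using K A_nonzero[of m] by simp
    qed (simp add: S_eq_0)
    hence "val_ge p (int s + 1) (- (\<Sum>m\<in>{1..<Suc K}. S K s m))"
      unfolding val_ge_minus by (intro val_ge_sum) auto
    also have "K < Suc K * p ^ s" using mult_le_mono[of "Suc K" "Suc K" 1 "p ^ s"] p_gt_1 by simp
    hence "(\<Sum>m<Suc K. S K s m) = 0" by (rule sum_S_eq_0)
    hence "- (\<Sum>m\<in>{1..<Suc K}. S K s m) = S K s 0"
      by (simp add: lessThan_atLeast0 sum.atLeast_Suc_lessThan del: sum.lessThan_Suc sum.op_ivl_Suc)
    finally show ?case .
  qed
  show ?case
  proof (cases "K < m * p ^ s")
    case False
    define K' where "K' = K - m * p ^ s"
    have K: "K = K' + m * p ^ s" using False by (simp add: K'_def)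
    show ?thesis using val_ge_add[OF shift_s[of K' m] zero[of K']] K by simp
  qed (simp add: S_eq_0)
qed

text \<open>The argument of \<open>H\<close> is truncated one base p digit at a time. The increment
  at level s is constant on blocks of length p^s, over which the bracket sums to
  \<open>S K s m\<close>. The weight \<open>A m\<close> cancels the denominator in
  \<open>dwork_congruence\<close>, and (h - s) + (s + 1) = h + 1.\<close>

corollary dwork_weighted_sum:
  fixes H :: "nat \<Rightarrow> rat"
  assumes "\<And>s m. val_ge p (h - int s) ((H (m * p ^ s) - H (m div p * p ^ Suc s)) * A m)"
  shows "val_ge p (h + 1) (\<Sum>j\<le>K. H j * (A (a + p * j) * A (K - j) - A j * A (a + p * (K - j))))"
proof -
  define R where "R = K"
  have R: "K < p ^ R" using less_le_trans[OF less_exp[of K] power_mono[of 2 p K]] p_gt_1 by (simp add: R_def)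
  have step: "val_ge p (h + 1) (\<Sum>j<p ^ R. (H (j div p ^ s * p ^ s) - H (j div p ^ Suc s * p ^ Suc s)) * T K j)"
    if "s < R" for s
  proof -
    have "(\<Sum>j<p ^ R. (H (j div p ^ s * p ^ s) - H (j div p ^ Suc s * p ^ Suc s)) * T K j) =
      (\<Sum>m<p ^ (R - s). \<Sum>j\<in>{m * p ^ s..<m * p ^ s + p ^ s}.
         (H (j div p ^ s * p ^ s) - H (j div p ^ Suc s * p ^ Suc s)) * T K j)"
      using that by (subst sum.nat_group) (simp flip: power_add)
    also have "\<dots> = (\<Sum>m<p ^ (R - s). (H (m * p ^ s) - H (m div p * p ^ Suc s)) * S K s m)"
    proof (rule sum.cong[OF refl])
      fix m
      have "j div p ^ s = m" "j div p ^ Suc s = m div p"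
        if "j \<in> {m * p ^ s..<m * p ^ s + p ^ s}" for j
      proof -
        show 1: "j div p ^ s = m" using that by (intro div_nat_eqI) (auto simp: algebra_simps)
        show "j div p ^ Suc s = m div p"
          using 1 by (metis div_mult2_eq power_Suc2)
      qed
      thus "(\<Sum>j\<in>{m * p ^ s..<m * p ^ s + p ^ s}.
         (H (j div p ^ s * p ^ s) - H (j div p ^ Suc s * p ^ Suc s)) * T K j) =
         (H (m * p ^ s) - H (m div p * p ^ Suc s)) * S K s m"
        by (simp add: S_def sum_distrib_left)
    qed
    also have "val_ge p (h + 1) \<dots>"
    proof (intro val_ge_sum)
      fix m
      have "val_ge p ((h - int s) + (int s + 1))
        ((H (m * p ^ s) - H (m div p * p ^ Suc s)) * A m * (S K s m / A m))"
        by (intro val_ge_mult assms dwork_congruence)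
      thus "val_ge p (h + 1) ((H (m * p ^ s) - H (m div p * p ^ Suc s)) * S K s m)"
        using A_nonzero[of m] by (simp add: mult.assoc)
    qed
    finally show ?thesis .
  qed
  have tele: "val_ge p (h + 1) (\<Sum>j<p ^ R. (H j - H (j div p ^ s * p ^ s)) * T K j)" if "s \<le> R" for s
    using that
  proof (induction s)
    case (Suc s)
    have "(\<Sum>j<p ^ R. (H j - H (j div p ^ Suc s * p ^ Suc s)) * T K j) =
      (\<Sum>j<p ^ R. (H j - H (j div p ^ s * p ^ s)) * T K j) +
      (\<Sum>j<p ^ R. (H (j div p ^ s * p ^ s) - H (j div p ^ Suc s * p ^ Suc s)) * T K j)"
      by (simp add: algebra_simps flip: sum.distrib)
    thus ?case using Suc step[of s] val_ge_add by simp
  qed simp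
  \<comment> \<open>For j < p^R the truncation at level \<open>R\<close> is 0, and the constant
    \<open>H 0\<close> drops out because the bracket sums to zero.\<close>
  have "(\<Sum>j<p ^ R. (H j - H (j div p ^ R * p ^ R)) * T K j) = (\<Sum>j<p ^ R. H j * T K j - H 0 * T K j)"
    by (intro sum.cong) (auto simp: algebra_simps)
  also have "\<dots> = (\<Sum>j<p ^ R. H j * T K j)"
    using sum_T_eq_0[OF R] by (simp add: sum_subtractf flip: sum_distrib_left)
  also have "\<dots> = (\<Sum>j\<le>K. H j * T K j)"
    using R by (intro sum.mono_neutral_right) (auto simp: T_def)
  also have "\<dots> = (\<Sum>j\<le>K. H j * (A (a + p * j) * A (K - j) - A j * A (a + p * (K - j))))"
    by (intro sum.cong) (auto simp: T_def)
  finally show ?thesis using tele[of R] by simp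
qed

end

end

section \<open>Multinomial coefficients and harmonic numbers\<close>

lemma harmonic_0 [simp]: "harmonic 0 = 0" by (simp add: harmonic_def)

lemma harmonic_Suc: "harmonic (Suc n) = harmonic n + 1 / of_nat (Suc n)"
  by (simp add: harmonic_def)

lemma harmonic_add: "harmonic (m + n) = harmonic m + (\<Sum>i=1..n. 1 / of_nat (m + i))"
  by (induction n) (simp_all add: harmonic_Suc add.assoc)

text \<open>The quotient counts partitions of Nm elements into N unlabelled blocks of size m. The
  induction uses C((N+1)m, m) = (N+1) C((N+1)m - 1, m - 1).\<close>

lemma fact_mult_factorization:
  assumes "m \<ge> 1"
  shows "\<exists>w::nat. fact (N * m) = fact N * fact m ^ N * w"
proof (induction N)
  case (Suc N)
  then obtain w :: nat where w: "fact (N * m) = fact N * fact m ^ N * w" by blast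
  define c where "c = (Suc N * m - 1 choose (m - 1))"
  have "m * (Suc N * m choose m) = m * (Suc N * c)"
    using times_binomial_minus1_eq[of m "Suc N * m"] assms
    unfolding c_def by (metis less_eq_Suc_le mult.assoc mult.commute One_nat_def)
  hence "(Suc N * m choose m) = Suc N * c" using assms by (metis mult_left_cancel not_one_le_zero)
  hence "fact (Suc N * m) = fact m * fact (N * m) * (Suc N * c)"
    using binomial_fact_lemma[of m "Suc N * m"] by (simp add: mult.assoc)
  hence "fact (Suc N * m) = fact (Suc N) * fact m ^ Suc N * (w * c)"
    using w by (simp add: algebra_simps)
  thus ?case by blast
qed auto

definition multinom :: "nat \<Rightarrow> nat \<Rightarrow> rat" where
  "multinom N m = fact (N * m) / fact m ^ N"

lemma multinom_0 [simp]: "multinom N 0 = 1" by (simp add: multinom_def)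

lemma multinom_1 [simp]: "multinom N (Suc 0) = fact N" by (simp add: multinom_def)

lemma multinom_nonzero [simp]: "multinom N m \<noteq> 0" by (simp add: multinom_def)

lemma multinom_over_fact: "m \<ge> 1 \<Longrightarrow> \<exists>w::nat. multinom N m = fact N * of_nat w"
proof -
  assume "m \<ge> 1"
  then obtain w :: nat where "fact (N * m) = fact N * fact m ^ N * w"
    using fact_mult_factorization by blast
  hence "(fact (N * m) :: rat) = fact N * fact m ^ N * of_nat w"
    by (metis of_nat_fact of_nat_mult of_nat_power)
  thus ?thesis by (auto simp: multinom_def)
qed

section \<open>Derivatives of rising products\<close>

definition prod_harm :: "nat \<Rightarrow> nat \<Rightarrow> rat" where
  "prod_harm X n = (\<Prod>i=1..n. of_nat (X + i)) * (\<Sum>i=1..n. 1 / of_nat (X + i))"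

lemma prod_shift_add:
  "(\<Prod>i=1..m+n. of_nat (X + i) :: rat) =
     (\<Prod>i=1..m. of_nat (X + i)) * (\<Prod>i=1..n. of_nat (X + m + i))"
  by (induction n) (simp_all add: algebra_simps)

text \<open>Leibniz rule: \<open>prod_harm X n\<close> is the derivative in X of
  (X+1)...(X+n).\<close>

lemma prod_harm_add:
  "prod_harm X (m + n) = prod_harm X m * (\<Prod>i=1..n. of_nat (X + m + i)) +
     (\<Prod>i=1..m. of_nat (X + i)) * prod_harm (X + m) n"
proof -
  have "(\<Sum>i=1..m+n. 1 / of_nat (X + i) :: rat) =
      (\<Sum>i=1..m. 1 / of_nat (X + i)) + (\<Sum>i=1..n. 1 / of_nat (X + m + i))"
    using harmonic_add[of X "m + n"] harmonic_add[of X m] harmonic_add[of "X + m" n]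
    by (simp add: add.assoc)
  thus ?thesis unfolding prod_harm_def prod_shift_add by (simp add: algebra_simps)
qed

text \<open>\<open>prod_harm X n / n!\<close> is the derivative of the polynomial \<open>binomial(X + n, n)\<close> in \<open>X\<close>,
  so Pascal's rule carries over to it.\<close>
lemma prod_harm_pascal:
  "prod_harm (Suc X) (Suc n) / fact (Suc n) =
     prod_harm X (Suc n) / fact (Suc n) + prod_harm (Suc X) n / fact n"
proof -
  define P s where "P = (\<Prod>i=1..n. of_nat (Suc X + i) :: rat)"
    and "s = (\<Sum>i=1..n. 1 / of_nat (Suc X + i) :: rat)"
  have 0: "prod_harm (Suc X) n = P * s" by (simp add: prod_harm_def P_def s_def)
  have 1: "prod_harm (Suc X) (Suc n) = P * s * of_nat (X + n + 2) + P"
    using prod_harm_add[of "Suc X" n 1] 0 by (simp add: prod_harm_def P_def)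
  have 2: "prod_harm X (Suc n) = P + of_nat (Suc X) * (P * s)"
    using prod_harm_add[of X 1 n] 0 by (simp add: prod_harm_def P_def)
  have "of_nat (X + n + 2) = of_nat (Suc X) + (of_nat (Suc n) :: rat)" by simp
  hence "prod_harm (Suc X) (Suc n) = prod_harm X (Suc n) + prod_harm (Suc X) n * of_nat (Suc n)"
    by (simp only: 0 1 2) (simp only: algebra_simps)
  thus ?thesis by (simp add: add_divide_distrib del: of_nat_Suc)
qed

section \<open>Denominators of harmonic sums\<close>

definition unit_harm :: "nat \<Rightarrow> nat \<Rightarrow> rat" where
  "unit_harm p y = (\<Sum>i<y. \<Sum>r=1..<p. 1 / of_nat (i * p + r))"

context prime_nat begin

lemma harmonic_mult_p: "harmonic (p * y) = harmonic y / of_nat p + unit_harm p y"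
proof (induction y)
  case (Suc y)
  have "harmonic (p * Suc y) = harmonic (p * y + p)" by (simp add: algebra_simps)
  also have "\<dots> = harmonic (p * y) + (\<Sum>i=1..p. 1 / of_nat (p * y + i))" by (rule harmonic_add)
  also have "{1..p} = insert p {1..<p}" using p_gt_1 by auto
  also have "(\<Sum>i\<in>insert p {1..<p}. 1 / of_nat (p * y + i) :: rat) =
      1 / of_nat (Suc y) / of_nat p + (\<Sum>r=1..<p. 1 / of_nat (y * p + r))"
    by (subst sum.insert) (simp_all add: algebra_simps)
  also have "harmonic (p * y) + \<dots> = harmonic (Suc y) / of_nat p + unit_harm p (Suc y)"
    unfolding Suc.IH harmonic_Suc add_divide_distrib by (simp add: unit_harm_def)
  finally show ?case .
qed (simp add: unit_harm_def)

lemma unit_harm_integral: "val_ge p 0 (unit_harm p y)"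
  unfolding unit_harm_def
  by (intro val_ge_sum val_ge_1_over_nat coprime_block_term) auto

lemma val_ge_1_over_small:
  assumes "0 < n" "n < p ^ Suc L"
  shows "val_ge p 0 (of_nat p ^ L * (1 / of_nat n))"
proof -
  obtain n' where n': "n = p ^ multiplicity p n * n'" "\<not> p dvd n'"
    using multiplicity_decompose'[of n p] assms by (metis less_irrefl not_prime_unit prime_p)
  define e where "e = multiplicity p n"
  have "p ^ e \<le> n" using multiplicity_dvd[of p n] assms by (auto simp: e_def intro: dvd_imp_le)
  hence "p ^ e < p ^ Suc L" using assms by linarith
  hence e: "e \<le> L" using p_gt_1 by (simp only: power_strict_increasing_iff less_Suc_eq_le)
  hence "(of_nat p :: rat) ^ L = of_nat p ^ (L - e) * of_nat p ^ e" by (simp flip: power_add)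
  moreover have "(of_nat n :: rat) = of_nat p ^ e * of_nat n'"
    using n' unfolding e_def by (metis of_nat_mult of_nat_power)
  ultimately have "of_nat p ^ L * (1 / of_nat n) = of_nat (p ^ (L - e)) * (1 / of_nat n' :: rat)"
    by simp
  also have "val_ge p 0 \<dots>" by (intro val_ge_0_mult val_ge_of_nat val_ge_1_over_nat n')
  finally show ?thesis .
qed

lemma val_ge_harmonic_small:
  assumes "n < p ^ Suc L"
  shows "val_ge p 0 (of_nat p ^ L * harmonic n)"
  unfolding harmonic_def sum_distrib_left
  by (intro val_ge_sum val_ge_1_over_small) (use assms in auto)

text \<open>At X = 0 the quotient is H_n, where p^L clears the powers of \<open>p\<close>; Pascal's
  rule carries the bound to all X, uniformly.\<close>

lemma val_ge_prod_harm:
  assumes "n < p ^ Suc L"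
  shows "val_ge p 0 (of_nat p ^ L * (prod_harm X n / fact n))"
  using assms
proof (induction n arbitrary: X)
  case (Suc n)
  note IH = Suc.IH and Suc_n = Suc.prems
  show ?case
  proof (induction X)
    case 0
    have "(\<Prod>i=1..Suc n. of_nat (0 + i) :: rat) = fact (Suc n)"
      by (simp only: fact_prod of_nat_prod add_0)
    hence "prod_harm 0 (Suc n) / fact (Suc n) = harmonic (Suc n)"
      unfolding prod_harm_def harmonic_def by simp
    thus ?case using val_ge_harmonic_small[OF Suc.prems] by simp
  next
    case (Suc X)
    show ?case
      unfolding prod_harm_pascal distrib_left
      by (intro val_ge_add Suc IH) (use Suc_n in simp)
  qed
qed (simp add: prod_harm_def)

lemma prod_shift_over_fact: "\<exists>w::nat. (\<Prod>i=1..n. of_nat (X + i) :: rat) = fact n * of_nat w"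
proof -
  have "fact (X + n) = fact X * (\<Prod>i=1..n. X + i)" by (rule fact_add_prod)
  moreover have "fact n * fact X * (X + n choose n) = (fact (X + n) :: nat)"
    using binomial_fact_lemma[of n "X + n"] by simp
  ultimately have "(\<Prod>i=1..n. X + i) = fact n * (X + n choose n)" by simp
  hence "(\<Prod>i=1..n. of_nat (X + i) :: rat) = fact n * of_nat (X + n choose n)"
    by (metis of_nat_fact of_nat_mult of_nat_prod)
  thus ?thesis by blast
qed

text \<open>By the Leibniz rule each summand differentiates only one of the \<open>a\<close> blocks
  of length n, at the cost of p^L; the other blocks divided by n! are binomial coefficients.\<close>

lemma val_ge_prod_harm_mult:
  assumes "n < p ^ Suc L"
  shows "val_ge p 0 (of_nat p ^ L * (prod_harm X (n * a) / fact n ^ a))"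
proof (induction a)
  case (Suc a)
  have 1: "val_ge p 0 ((\<Prod>i=1..n. of_nat (X + n * a + i)) / fact n)"
    using prod_shift_over_fact[where X = "X + n * a" and n = n] by auto
  have 2: "val_ge p 0 ((\<Prod>i=1..n * a. of_nat (X + i)) / fact n ^ a)" for a
  proof (induction a)
    case (Suc a)
    have "(\<Prod>i=1..n * Suc a. of_nat (X + i) :: rat) =
        (\<Prod>i=1..n * a. of_nat (X + i)) * (\<Prod>i=1..n. of_nat (X + n * a + i))"
      using prod_shift_add[of X "n * a" n] by (simp add: add.commute)
    thus ?case using val_ge_0_mult[OF Suc] prod_shift_over_fact[where X = "X + n * a" and n = n] by auto
  qed simp
  have "of_nat p ^ L * (prod_harm X (n * Suc a) / fact n ^ Suc a) =
      of_nat p ^ L * (prod_harm X (n * a) / fact n ^ a) * ((\<Prod>i=1..n. of_nat (X + n * a + i)) / fact n) +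
      (\<Prod>i=1..n * a. of_nat (X + i)) / fact n ^ a * (of_nat p ^ L * (prod_harm (X + n * a) n / fact n))"
    using prod_harm_add[of X "n * a" n] by (simp add: add.commute field_simps)
  also have "val_ge p 0 \<dots>"
    by (intro val_ge_add val_ge_0_mult Suc 1 2 val_ge_prod_harm assms)
  finally show ?case .
qed (simp add: prod_harm_def)

lemma val_ge_power_diff:
  assumes "val_ge p e (x - y)" "val_ge p 0 x" "val_ge p 0 y"
  shows "val_ge p e (x ^ k - y ^ k)"
proof (induction k)
  case (Suc k)
  have "x ^ Suc k - y ^ Suc k = (x - y) * x ^ k + (x ^ k - y ^ k) * y" by (simp add: algebra_simps)
  also have "val_ge p e \<dots>" using assms Suc by (intro val_ge_add val_ge_mult_0 val_ge_power)
  finally show ?case .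
qed simp

section \<open>Congruences for ratios of multinomial coefficients\<close>

lemma unit_block_cong: "[unit_block p (i + n * p ^ s) = unit_block p i] (mod p ^ Suc s)"
  unfolding unit_block_def
proof (intro cong_prod)
  fix r
  have "(i + n * p ^ s) * p + r = (i * p + r) + n * p ^ Suc s" by (simp add: algebra_simps)
  thus "[(i + n * p ^ s) * p + r = i * p + r] (mod p ^ Suc s)" by (simp only: cong_def mod_mult_self1)
qed

text \<open>Modulo p^(s+1) the blocks have period p^s in their index, so every full period
  contributes the same factor.\<close>

lemma unit_fact_cong:
  "[unit_fact p (y + z * p ^ s) = unit_fact p (p ^ s) ^ z * unit_fact p y] (mod p ^ Suc s)"
proof (induction z)
  case (Suc z)
  have "unit_fact p (n + m) = unit_fact p n * (\<Prod>i<m. unit_block p (i + n))" for m n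
    by (induction m) (simp_all add: unit_fact_def add.commute)
  from this[of "p ^ s" "y + z * p ^ s"]
  have "unit_fact p (y + Suc z * p ^ s) =
      unit_fact p (p ^ s) * (\<Prod>i<y + z * p ^ s. unit_block p (i + 1 * p ^ s))"
    by (simp add: algebra_simps)
  moreover have "[(\<Prod>i<y + z * p ^ s. unit_block p (i + 1 * p ^ s)) =
      unit_fact p (y + z * p ^ s)] (mod p ^ Suc s)"
    unfolding unit_fact_def by (intro cong_prod unit_block_cong)
  from cong_trans[OF this Suc.IH]
  have "[unit_fact p (p ^ s) * (\<Prod>i<y + z * p ^ s. unit_block p (i + 1 * p ^ s)) =
      unit_fact p (p ^ s) * (unit_fact p (p ^ s) ^ z * unit_fact p y)] (mod p ^ Suc s)"
    by (rule cong_scalar_left)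
  ultimately show ?case by (simp only: power_Suc mult.assoc)
qed simp

text \<open>Numerator of the ratio of the multinomial coefficients at v + py and y once p^(Ny) is
  cancelled; \<open>step_den\<close> is the matching denominator, a unit for v < p.\<close>

definition step_num :: "nat \<Rightarrow> nat \<Rightarrow> nat \<Rightarrow> nat" where
  "step_num N v y = unit_fact p (N * y) * (\<Prod>i=1..N * v. N * (p * y) + i)"

definition step_den :: "nat \<Rightarrow> nat \<Rightarrow> nat \<Rightarrow> nat" where
  "step_den N v y = (unit_fact p y * (\<Prod>i=1..v. p * y + i)) ^ N"

lemma step_den_unit: "v < p \<Longrightarrow> \<not> p dvd step_den N v y"
  unfolding step_den_def using unit_fact_unit fact_split_p(2)[of v y] prime_p
  by (intro not_dvd_power) (simp add: prime_dvd_mult_iff)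

lemma multinom_step:
  assumes "v < p"
  shows "multinom N (v + p * y) = multinom N y * (of_nat (step_num N v y) / of_nat (step_den N v y))"
proof -
  have "N * (v + p * y) = N * (p * y) + N * v" by (simp add: algebra_simps)
  hence "fact (N * (v + p * y)) = fact (p * (N * y)) * (\<Prod>i=1..N * v. N * (p * y) + i)"
    by (simp only: fact_add_prod mult.left_commute[of N p y])
  hence 1: "fact (N * (v + p * y)) = p ^ (N * y) * fact (N * y) * step_num N v y"
    by (simp add: fact_mult_p step_num_def)
  have 2: "fact (v + p * y) ^ N = p ^ (N * y) * fact y ^ N * step_den N v y"
    using fact_split_p(1)[OF assms, of y]
    by (simp add: fact_mult_p step_den_def power_mult_distrib mult_ac flip: power_mult)
  have "(fact (N * (v + p * y)) :: rat) = of_nat (p ^ (N * y) * fact (N * y) * step_num N v y)"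
    unfolding 1[symmetric] by simp
  moreover have "(fact (v + p * y) ^ N :: rat) = of_nat (p ^ (N * y) * fact y ^ N * step_den N v y)"
    unfolding 2[symmetric] by simp
  ultimately show ?thesis by (simp add: multinom_def)
qed

lemma prod_cong_shift:
  "[(\<Prod>i=1..m. c * (p * (u + n * p ^ s)) + i) = (\<Prod>i=1..m. c * (p * u) + i)] (mod p ^ Suc s)"
proof (intro cong_prod)
  fix i
  have "c * (p * (u + n * p ^ s)) + i = c * (p * u) + i + c * n * p ^ Suc s"
    by (simp add: algebra_simps)
  thus "[c * (p * (u + n * p ^ s)) + i = c * (p * u) + i] (mod p ^ Suc s)"
    by (simp only: cong_def mod_mult_self1)
qed

text \<open>Shifting the argument by \<open>n p\<^sup>s\<close> multiplies numerator and denominator by the same power of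
  \<open>unit_fact p (p ^ s)\<close>, so Wilson's theorem is not needed.\<close>
lemma step_quotient_cong:
  assumes v: "v < p"
  shows "val_ge p (int s + 1)
    (of_nat (step_num N v (u + n * p ^ s)) / of_nat (step_den N v (u + n * p ^ s)) -
     of_nat (step_num N v u) / of_nat (step_den N v u))"
proof -
  define a where "a = step_num N v u"
  define b where "b = step_den N v u"
  define a' where "a' = step_num N v (u + n * p ^ s)"
  define b' where "b' = step_den N v (u + n * p ^ s)"
  define w where "w = unit_fact p (p ^ s) ^ (N * n)"
  have "[a' = unit_fact p (p ^ s) ^ (N * n) * unit_fact p (N * u) * (\<Prod>i=1..N * v. N * (p * u) + i)] (mod p ^ Suc s)"
    unfolding a'_def step_num_def distrib_left[of N] mult.assoc[of N n "p ^ s", symmetric]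
    by (intro cong_mult unit_fact_cong)
       (use prod_cong_shift[of N u n s "N * v"] in \<open>simp add: distrib_left mult.assoc\<close>)
  hence a: "[a' = w * a] (mod p ^ Suc s)" by (simp add: w_def a_def step_num_def mult.assoc)
  have "[b' = (unit_fact p (p ^ s) ^ n * unit_fact p u * (\<Prod>i=1..v. p * u + i)) ^ N] (mod p ^ Suc s)"
    unfolding b'_def step_den_def
    by (intro cong_pow cong_mult unit_fact_cong) (use prod_cong_shift[of 1 u n s v] in simp)
  hence b: "[b' = w * b] (mod p ^ Suc s)"
    by (simp add: w_def b_def step_den_def power_mult_distrib mult_ac flip: power_mult)
  have "[a' * b = (w * a) * b] (mod p ^ Suc s)" by (intro cong_mult a cong_refl)
  moreover have "[a * b' = a * (w * b)] (mod p ^ Suc s)" by (intro cong_mult b cong_refl)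
  ultimately have "[a' * b = a * b'] (mod p ^ Suc s)"
    by (metis cong_sym cong_trans mult.assoc mult.commute)
  from val_ge_cong_nat[OF this]
  have c: "val_ge p (int s + 1) (of_nat (a' * b) - of_nat (a * b'))" by (simp add: add.commute)
  have nd: "\<not> p dvd b" "\<not> p dvd b'" using step_den_unit[OF v] by (auto simp: b_def b'_def)
  hence "\<not> p dvd b * b'" using prime_p by (simp add: prime_dvd_mult_iff)
  from val_ge_divide_nat[OF c this]
  have "val_ge p (int s + 1) ((of_nat (a' * b) - of_nat (a * b')) / of_nat (b * b'))" .
  moreover have "b \<noteq> 0" "b' \<noteq> 0" using nd by (auto intro: ccontr)
  hence "(of_nat (a' * b) - of_nat (a * b')) / of_nat (b * b') =
      (of_nat a' / of_nat b' - of_nat a / of_nat b :: rat)"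
    by (simp add: field_simps)
  ultimately show ?thesis unfolding a_def b_def a'_def b'_def by simp
qed

lemma multinom_dwork_sequence:
  "dwork_sequence p (\<lambda>m. multinom N m ^ k)
     (\<lambda>v y. (of_nat (step_num N v y) / of_nat (step_den N v y)) ^ k)"
proof
  show "multinom N 0 ^ k = 1" "multinom N n ^ k \<noteq> 0" for n by simp_all
  have int: "val_ge p 0 (of_nat (step_num N v y) / of_nat (step_den N v y))" if "v < p" for v y
    by (intro val_ge_divide_nat val_ge_of_nat step_den_unit that)
  show "multinom N (v + p * y) ^ k =
      multinom N y ^ k * (of_nat (step_num N v y) / of_nat (step_den N v y)) ^ k"
    if "v < p" for v y
    using multinom_step[OF that] by (simp only: power_mult_distrib)
  show "val_ge p 0 ((of_nat (step_num N v y) / of_nat (step_den N v y)) ^ k)" if "v < p" for v y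
    using int[OF that] by (rule val_ge_power)
  show "val_ge p (int s + 1)
     ((of_nat (step_num N v (u + n * p ^ s)) / of_nat (step_den N v (u + n * p ^ s))) ^ k -
      (of_nat (step_num N v u) / of_nat (step_den N v u)) ^ k)" if "v < p" for v s u n
    by (intro val_ge_power_diff step_quotient_cong int that)
qed

end

section \<open>The congruence at a single prime\<close>

text \<open>\<open>h\<close> is an integer because \<open>Xi\<close> may have negative exponents.
  The extra p^L demanded of N! compensates the denominators p^L of harmonic sums of length at most
  N.\<close>

locale mirror_map_at_prime = prime_nat +
  fixes N k L :: nat and h :: int
  assumes k_pos: "k > 0"
    and harmonic_N: "val_ge p h (harmonic N)"
    and N_less: "N < p ^ Suc L"
    and fact_N: "val_ge p (h + int L) (fact N)"
    and unit_harm_N: "val_ge p h (unit_harm p (N * x))"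
begin

lemma multinom_over_fact_integral: "m \<ge> 1 \<Longrightarrow> val_ge p 0 (multinom N m / fact N)"
  using multinom_over_fact[of m N] by auto

lemma multinom_integral: "val_ge p 0 (multinom N m)"
proof (cases "m = 0")
  case False
  thus ?thesis using multinom_over_fact[of m N] val_ge_0_mult[OF val_ge_fact val_ge_of_nat] by fastforce
qed simp

lemma coeff_over_fact_integral: "m \<ge> 1 \<Longrightarrow> val_ge p 0 (multinom N m ^ k / fact N ^ k)"
  using val_ge_power[OF multinom_over_fact_integral] by (simp add: power_divide)

text \<open>The harmonic difference times its product is N!^a times a quantity with denominator at
  most p^L. One N! pays for p^(h+L) and another for the division: for a >= 2 both come from N!^a,
  for a = 1 and y >= 1 the second sits in \<open>multinom N y\<close>. For a = 1, y = 0 the claim is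
  the condition on H_N.\<close>

lemma multinom_harmonic_diff:
  assumes a: "a < p"
  shows "val_ge p h (multinom N (a + p * y) / fact N *
    (harmonic (N * (a + p * y)) - harmonic (N * (p * y))))"
proof -
  define X where "X = N * (p * y)"
  define c :: rat where "c = of_nat (unit_fact p (N * y)) / of_nat (step_den N a y)"
  define D where "D = harmonic (N * (a + p * y)) - harmonic X"
  have c: "val_ge p 0 c"
    unfolding c_def by (intro val_ge_divide_nat val_ge_of_nat step_den_unit a)
  have "N * (a + p * y) = X + N * a" by (simp add: X_def algebra_simps)
  hence D: "D = (\<Sum>i=1..N * a. 1 / of_nat (X + i))" by (simp add: D_def harmonic_add)
  have "(of_nat (step_num N a y) :: rat) =
      of_nat (unit_fact p (N * y)) * (\<Prod>i=1..N * a. of_nat (X + i))"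
    by (simp only: step_num_def X_def of_nat_mult of_nat_prod)
  hence key: "multinom N (a + p * y) * D = multinom N y * c * prod_harm X (N * a)"
    by (simp add: multinom_step[OF a] D c_def prod_harm_def)
  have f: "val_ge p h (fact N / of_nat p ^ L)"
    using val_ge_divide_p_powi[OF fact_N] by simp
  have e: "val_ge p 0 (of_nat p ^ L * (prod_harm X (N * a) / fact N ^ a))"
    by (rule val_ge_prod_harm_mult[OF N_less])
  consider "a = 0" | "a = 1" "y = 0" | "a = 1" "y \<ge> 1" | "a \<ge> 2" by linarith
  hence "val_ge p h (multinom N (a + p * y) * D / fact N)"
  proof cases
    case 1 thus ?thesis by (simp add: D)
  next
    case 2 thus ?thesis using harmonic_N by (simp add: D_def X_def)
  next
    case 3
    have "multinom N (a + p * y) * D / fact N = multinom N y / fact N * c *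
        (of_nat p ^ L * (prod_harm X (N * a) / fact N ^ a)) * (fact N / of_nat p ^ L)"
      unfolding key using 3 by simp
    also have "val_ge p h \<dots>"
      using 3 by (intro val_ge_0_mult'[OF _ f] val_ge_0_mult multinom_over_fact_integral c e)
    finally show ?thesis .
  next
    case 4
    have "(fact N :: rat) ^ a = fact N ^ (a - 2) * fact N * fact N"
      using 4 by (metis add_diff_inverse_nat not_less power_add power2_eq_square mult.assoc mult.commute)
    hence "multinom N (a + p * y) * D / fact N = multinom N y * c *
        (of_nat p ^ L * (prod_harm X (N * a) / fact N ^ a)) * fact N ^ (a - 2) * (fact N / of_nat p ^ L)"
      unfolding key by simp
    also have "val_ge p h \<dots>"
      by (intro val_ge_0_mult'[OF _ f] val_ge_0_mult multinom_integral c e val_ge_power val_ge_fact)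
    finally show ?thesis .
  qed
  thus ?thesis by (simp add: D_def X_def)
qed

text \<open>One of the \<open>k\<close> factors carries the estimate and the others stay integral
  after division by N!; at index 0 the difference vanishes.\<close>

lemma coeff_harmonic_diff:
  assumes "a < p"
  shows "val_ge p h (multinom N (a + p * y) ^ k / fact N ^ k *
    (harmonic (N * (a + p * y)) - harmonic (N * (p * y))))"
proof (cases "a + p * y = 0")
  case False
  hence pos: "a + p * y \<ge> 1" by linarith
  obtain k' where k: "k = Suc k'" using k_pos by (cases k) auto
  have "val_ge p h ((multinom N (a + p * y) / fact N) ^ k' * (multinom N (a + p * y) / fact N *
      (harmonic (N * (a + p * y)) - harmonic (N * (p * y)))))"
    by (intro val_ge_0_mult'[OF val_ge_power] multinom_over_fact_integral pos
        multinom_harmonic_diff assms)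
  thus ?thesis by (simp add: k power_divide mult_ac)
qed simp

lemma harmonic_p_power: "val_ge p h (of_nat p ^ s * harmonic (N * x * p ^ s) - harmonic (N * x))"
proof (induction s)
  case (Suc s)
  have "N * x * p ^ Suc s = p * (N * x * p ^ s)" by simp
  hence "of_nat p ^ Suc s * harmonic (N * x * p ^ Suc s) - harmonic (N * x) =
      (of_nat p ^ s * harmonic (N * x * p ^ s) - harmonic (N * x)) +
      unit_harm p (N * (x * p ^ s)) * of_nat (p ^ Suc s)"
    by (simp only: harmonic_mult_p) (simp add: algebra_simps)
  also have "val_ge p h \<dots>" by (intro val_ge_add Suc val_ge_mult_0 unit_harm_N val_ge_of_nat)
  finally show ?case .
qed simp

text \<open>The hypothesis of \<open>dwork_weighted_sum\<close> for H_(Nj)/N!^k. Modulo p^h,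
  multiplication by p^s turns the difference into H_(Nm) - H_(Npy) with y = m div p, where only the
  last digit of m is dropped.\<close>

lemma coeff_harmonic_p_power_diff:
  "val_ge p (h - int s) ((harmonic (N * (m * p ^ s)) / fact N ^ k -
     harmonic (N * (m div p * p ^ Suc s)) / fact N ^ k) * multinom N m ^ k)"
proof (cases "m = 0")
  case False
  define a y where "a = m mod p" and "y = m div p"
  have m: "m = a + p * y" and a: "a < p" using p_gt_1 by (simp_all add: a_def y_def)
  define c where "c = multinom N m ^ k / fact N ^ k"
  define D where "D = harmonic (N * m) - harmonic (N * (p * y))"
  define D' where "D' = harmonic (N * (m * p ^ s)) - harmonic (N * (y * p ^ Suc s))"
  have c: "val_ge p 0 c" unfolding c_def using False by (intro coeff_over_fact_integral) simp
  have cD: "val_ge p h (c * D)" unfolding c_def D_def m by (rule coeff_harmonic_diff[OF a])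
  have "val_ge p h (of_nat p ^ s * D' - D)"
    using val_ge_diff[OF harmonic_p_power[of s m] harmonic_p_power[of s "p * y"]]
    by (simp add: D_def D'_def algebra_simps)
  hence "val_ge p h (c * (of_nat p ^ s * D' - D) + c * D)"
    by (intro val_ge_add val_ge_0_mult' c cD)
  hence "val_ge p ((h - int s) + int s) (of_nat p ^ s * (c * D'))" by (simp add: algebra_simps)
  from val_ge_divide_p_powi[OF this] have "val_ge p (h - int s) (c * D')" by simp
  moreover have "c * D' = (harmonic (N * (m * p ^ s)) / fact N ^ k -
     harmonic (N * (m div p * p ^ Suc s)) / fact N ^ k) * multinom N m ^ k"
    by (simp add: c_def D'_def y_def field_simps)
  ultimately show ?thesis by simp
qed simp

lemma F_series_nth: "F_series N k $ m = multinom N m ^ k"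
  by (simp add: F_series_def multinom_def power_divide mult.commute flip: power_mult)

lemma G_series_nth: "G_series N k $ m = harmonic (N * m) * multinom N m ^ k"
  by (simp add: G_series_def multinom_def power_divide mult.commute flip: power_mult)

lemma fps_mult_compose_X_power_nth:
  assumes a: "a < p"
  shows "((f :: rat fps) * (g oo fps_X ^ p)) $ (a + p * K) = (\<Sum>j\<le>K. f $ (a + p * (K - j)) * g $ j)"
proof -
  have "(f * (g oo fps_X ^ p)) $ (a + p * K) =
      (\<Sum>i=0..a + p * K. (g oo fps_X ^ p) $ i * f $ (a + p * K - i))"
    by (subst mult.commute) (simp add: fps_mult_nth)
  also have "\<dots> = (\<Sum>i\<in>(\<lambda>j. p * j) ` {..K}. (g oo fps_X ^ p) $ i * f $ (a + p * K - i))"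
  proof (intro sum.mono_neutral_right ballI)
    fix i assume i: "i \<in> {0..a + p * K} - (\<lambda>j. p * j) ` {..K}"
    have "\<not> p dvd i"
    proof
      assume "p dvd i"
      then obtain j where j: "i = p * j" by auto
      have "p * j < p * Suc K" using i j a by auto
      hence "j \<le> K" by (simp only: mult_less_cancel1 less_Suc_eq_le)
      thus False using i j by auto
    qed
    thus "(g oo fps_X ^ p) $ i * f $ (a + p * K - i) = 0"
      using p_gt_1 by (simp add: fps_compose_X_power_nth)
  qed (auto simp: trans_le_add2)
  also have "\<dots> = (\<Sum>j\<le>K. (g oo fps_X ^ p) $ (p * j) * f $ (a + p * K - p * j))"
    using p_gt_1 by (subst sum.reindex) (auto simp: inj_on_def)
  also have "\<dots> = (\<Sum>j\<le>K. f $ (a + p * (K - j)) * g $ j)"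
    using p_gt_1 by (intro sum.cong)
      (auto simp: fps_compose_X_power_nth diff_mult_distrib2 mult.commute Nat.add_diff_assoc)
  finally show ?thesis .
qed

theorem FG_congruence:
  "val_ge p (h + 1) ((F_series N k * (G_series N k oo fps_X ^ p) -
     of_nat p * (G_series N k * (F_series N k oo fps_X ^ p))) $ n / fact N ^ k)"
proof -
  define a K where "a = n mod p" and "K = n div p"
  have n: "n = a + p * K" and a: "a < p" using p_gt_1 by (simp_all add: a_def K_def)
  define A where "A = (\<lambda>m. multinom N m ^ k)"
  define H where "H = (\<lambda>j. harmonic (N * j) / fact N ^ k)"
  \<comment> \<open>\<open>E\<close> is the error of replacing p H_(N(a+pj)) by H_(Nj).\<close>
  define E where "E = (\<lambda>j. (of_nat p * harmonic (N * (a + p * j)) - harmonic (N * j)) / fact N ^ k)"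
  interpret dwork_sequence p A
    "\<lambda>v y. (of_nat (step_num N v y) / of_nat (step_den N v y)) ^ k"
    unfolding A_def by (rule multinom_dwork_sequence)
  have E: "val_ge p (h + 1) (A (a + p * j) * E j)" for j
  proof -
    define c where "c = A (a + p * j) / fact N ^ k"
    have 1: "val_ge p h (c * (harmonic (N * (a + p * j)) - harmonic (N * (p * j))))"
      unfolding c_def A_def by (rule coeff_harmonic_diff[OF a])
    have 2: "val_ge p h (c * unit_harm p (N * j))"
    proof (cases "j = 0")
      case False
      hence "p * j > 0" using p_gt_1 by simp
      hence "a + p * j \<ge> 1" by linarith
      thus ?thesis unfolding c_def A_def
        by (intro val_ge_0_mult' coeff_over_fact_integral unit_harm_N)
    qed (simp add: unit_harm_def)
    have Npj: "N * (p * j) = p * (N * j)" by simp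
    have H: "harmonic (N * j) = of_nat p * (harmonic (N * (p * j)) - unit_harm p (N * j))"
      unfolding Npj harmonic_mult_p by simp
    have "A (a + p * j) * E j = of_nat p *
      (c * (harmonic (N * (a + p * j)) - harmonic (N * (p * j))) + c * unit_harm p (N * j))"
      unfolding E_def H by (simp add: c_def algebra_simps add_divide_distrib diff_divide_distrib)
    thus ?thesis using val_ge_add[OF 1 2] by (simp add: val_ge_p_times)
  qed
  have "(F_series N k * (G_series N k oo fps_X ^ p) -
     of_nat p * (G_series N k * (F_series N k oo fps_X ^ p))) $ n / fact N ^ k =
    ((\<Sum>j\<le>K. A (a + p * (K - j)) * (harmonic (N * j) * A j)) -
     of_nat p * (\<Sum>j\<le>K. harmonic (N * (a + p * (K - j))) * A (a + p * (K - j)) * A j)) / fact N ^ k"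
    unfolding n fps_of_nat[symmetric] fps_sub_nth fps_mult_left_const_nth
      fps_mult_compose_X_power_nth[OF a] F_series_nth G_series_nth A_def by simp
  also have "\<dots> = (\<Sum>j\<le>K. A (a + p * (K - j)) * A j * (H j - H (K - j)) - A (a + p * (K - j)) * E (K - j) * A j)"
    unfolding sum_distrib_left sum_subtractf[symmetric] sum_divide_distrib
    by (intro sum.cong refl) (simp add: H_def E_def field_simps)
  \<comment> \<open>Reflecting j to K - j in the half weighted by \<open>H (K - j)\<close> produces
    Dwork's bracket.\<close>
  also have "\<dots> = - (\<Sum>j\<le>K. H j * (A (a + p * j) * A (K - j) - A j * A (a + p * (K - j)))) -
      (\<Sum>j\<le>K. A (a + p * (K - j)) * E (K - j) * A j)"
  proof -
    have "(\<Sum>j\<le>K. A (a + p * (K - j)) * A j * H (K - j)) = (\<Sum>j\<le>K. A (a + p * j) * A (K - j) * H j)"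
      using sum.nat_diff_reindex[of "\<lambda>j. A (a + p * j) * A (K - j) * H j" "Suc K"]
      by (simp add: lessThan_Suc_atMost)
    thus ?thesis by (simp add: sum_subtractf sum.distrib algebra_simps)
  qed
  also have "val_ge p (h + 1) \<dots>"
    unfolding val_ge_minus
  proof (intro val_ge_diff)
    show "val_ge p (h + 1) (- (\<Sum>j\<le>K. H j * (A (a + p * j) * A (K - j) - A j * A (a + p * (K - j)))))"
      unfolding val_ge_minus
      by (rule dwork_weighted_sum[OF a]) (use coeff_harmonic_p_power_diff in \<open>simp add: H_def A_def\<close>)
  qed (intro val_ge_sum val_ge_mult_0 E A_integral)
  finally show ?thesis .
qed

end

section \<open>Wolstenholme's congruence\<close>

context prime_nat begin

lemma val_ge_2_over: "p > 2 \<Longrightarrow> val_ge p n (2 * x) \<Longrightarrow> val_ge p n x"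
  using val_ge_divide_nat[of n "2 * x" 2] by (auto simp: nat_dvd_not_less)

text \<open>Pairing \<open>r\<close> with \<open>p - r\<close> and using
  \<open>(bp + r)(bp + p - r) = r(p - r) + b(b + 1)p\<^sup>2\<close>.\<close>
lemma harmonic_block_cong:
  assumes p: "p > 2"
  shows "val_ge p 3 ((\<Sum>r=1..<p. 1 / of_nat (b * p + r)) - of_nat (2 * b + 1) * harmonic (p - 1))"
proof (rule val_ge_2_over[OF p])
  have pair: "2 * (\<Sum>r=1..<p. 1 / of_nat (b * p + r) :: rat) =
      of_nat (2 * b + 1) * of_nat p * (\<Sum>r=1..<p. 1 / of_nat ((b * p + r) * (b * p + (p - r))))" for b
  proof -
    have "2 * (\<Sum>r=1..<p. 1 / of_nat (b * p + r) :: rat) =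
        (\<Sum>r=1..<p. 1 / of_nat (b * p + r)) + (\<Sum>r=1..<p. 1 / of_nat (b * p + (p - r)))"
      by (subst (3) sum.atLeastLessThan_rev) simp
    also have "\<dots> = (\<Sum>r=1..<p. of_nat (2 * b + 1) * of_nat p * (1 / of_nat ((b * p + r) * (b * p + (p - r)))))"
      unfolding sum.distrib[symmetric]
    proof (intro sum.cong refl)
      fix r assume r: "r \<in> {1..<p}"
      define u v where "u = b * p + r" and "v = b * p + (p - r)"
      have uv: "u > 0" "v > 0" "u + v = (2 * b + 1) * p" using r by (auto simp: u_def v_def algebra_simps)
      have "1 / of_nat u + 1 / of_nat v = of_nat (u + v) * (1 / of_nat (u * v) :: rat)"
        using uv(1,2) by (simp add: field_simps)
      thus "1 / of_nat (b * p + r) + 1 / of_nat (b * p + (p - r)) =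
          of_nat (2 * b + 1) * of_nat p * (1 / of_nat ((b * p + r) * (b * p + (p - r))) :: rat)"
        unfolding uv(3) unfolding u_def v_def of_nat_mult[of "2 * b + 1" p] .
    qed
    finally show ?thesis by (simp only: sum_distrib_left)
  qed
  have H: "harmonic (p - 1) = (\<Sum>r=1..<p. 1 / of_nat (0 * p + r))"
    unfolding harmonic_def by (intro sum.cong) (use p in auto)
  have "2 * ((\<Sum>r=1..<p. 1 / of_nat (b * p + r)) - of_nat (2 * b + 1) * harmonic (p - 1)) =
      of_nat (2 * b + 1) * (of_nat p * (\<Sum>r=1..<p. 1 / of_nat ((b * p + r) * (b * p + (p - r))) - 1 / of_nat (r * (p - r))))"
    using pair[of b] pair[of 0] unfolding H sum_subtractf by (simp add: algebra_simps)
  also have "val_ge p 3 \<dots>"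
  proof (rule val_ge_0_mult'[OF val_ge_of_nat])
    have "val_ge p 2 (1 / of_nat ((b * p + r) * (b * p + (p - r))) - 1 / of_nat (r * (p - r)))"
      if "r \<in> {1..<p}" for r
    proof -
      define t where "t = p - r"
      define u v where "u = b * p + r" and "v = b * p + t"
      have pt: "p = r + t" and t: "0 < t" "t < p" using that by (auto simp: t_def)
      have nd: "\<not> p dvd u" "\<not> p dvd v" "\<not> p dvd r" "\<not> p dvd t"
        using that t coprime_block_term[of _ b] coprime_block_term[of _ 0] by (auto simp: u_def v_def)
      hence nz: "u \<noteq> 0" "v \<noteq> 0" "r \<noteq> 0" "t \<noteq> 0" by (auto intro: ccontr)
      have "u * v = r * t + p ^ 2 * (b * (b + 1))"
        unfolding u_def v_def by (subst (1 2 3) pt) (simp add: algebra_simps power2_eq_square)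
      hence "(of_nat (u * v) :: rat) = of_nat (r * t) + of_nat p ^ 2 * of_nat (b * (b + 1))"
        by (simp only: of_nat_add of_nat_mult of_nat_power)
      hence "of_nat (r * t) - of_nat (u * v) = - (of_nat p ^ 2 * of_nat (b * (b + 1)) :: rat)" by simp
      moreover have "1 / of_nat (u * v) - 1 / of_nat (r * t) =
          (of_nat (r * t) - of_nat (u * v)) * (1 / of_nat (u * v * (r * t)) :: rat)"
        using nz by (simp add: field_simps)
      ultimately have "1 / of_nat (u * v) - 1 / of_nat (r * t) =
          - (of_nat p ^ 2 * of_nat (b * (b + 1)) * (1 / of_nat (u * v * (r * t))) :: rat)"
        by (simp only: mult_minus_left)
      also have "val_ge p 2 \<dots>"
        unfolding val_ge_minus
        by (intro val_ge_mult_0 val_ge_of_nat val_ge_1_over_nat)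
           (use val_ge_p_power[of 2] nd prime_p in \<open>auto simp: prime_dvd_mult_iff\<close>)
      finally show ?thesis unfolding u_def v_def t_def .
    qed
    thus "val_ge p 3 (of_nat p * (\<Sum>r=1..<p. 1 / of_nat ((b * p + r) * (b * p + (p - r))) - 1 / of_nat (r * (p - r))))"
      unfolding val_ge_p_times by (intro val_ge_sum) simp
  qed
  finally show "val_ge p 3 (2 * ((\<Sum>r=1..<p. 1 / of_nat (b * p + r)) - of_nat (2 * b + 1) * harmonic (p - 1)))" .
qed

text \<open>Sum the block congruences; the first n odd numbers add up to n^2.\<close>

lemma unit_harm_cong:
  assumes "p > 2"
  shows "val_ge p 3 (unit_harm p n - of_nat (n ^ 2) * harmonic (p - 1))"
proof -
  have "(\<Sum>b<n. 2 * b + 1) = n ^ 2" by (induction n) (auto simp: power2_eq_square)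
  hence "unit_harm p n - of_nat (n ^ 2) * harmonic (p - 1) =
     (\<Sum>b<n. (\<Sum>r=1..<p. 1 / of_nat (b * p + r)) - of_nat (2 * b + 1) * harmonic (p - 1))"
    unfolding unit_harm_def sum_subtractf sum_distrib_right[symmetric] of_nat_sum[symmetric] by simp
  also have "val_ge p 3 \<dots>" by (intro val_ge_sum harmonic_block_cong assms)
  finally show ?thesis .
qed

lemma bij_double_mod: "p > 2 \<Longrightarrow> bij_betw (\<lambda>r. 2 * r mod p) {1..<p} {1..<p}"
proof -
  assume p: "p > 2"
  have cop: "coprime 2 p" using p prime_p primes_coprime[of 2 p] two_is_prime_nat by auto
  have sub: "(\<lambda>r. 2 * r mod p) ` {1..<p} \<subseteq> {1..<p}"
  proof safe
    fix r assume r: "r \<in> {1..<p}"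
    have "\<not> p dvd r" using r by (auto simp: nat_dvd_not_less)
    moreover have "\<not> p dvd 2" using p by (auto simp: nat_dvd_not_less)
    ultimately have "\<not> p dvd 2 * r" using prime_p by (simp add: prime_dvd_mult_iff)
    thus "2 * r mod p \<in> {1..<p}" using p by (auto simp: dvd_eq_mod_eq_0 Suc_le_eq)
  qed
  have inj: "inj_on (\<lambda>r. 2 * r mod p) {1..<p}"
  proof
    fix x y assume *: "x \<in> {1..<p}" "y \<in> {1..<p}" "2 * x mod p = 2 * y mod p"
    hence "[2 * x = 2 * y] (mod p)" by (simp add: cong_def)
    hence "[x = y] (mod p)" using cop by (simp add: cong_mult_lcancel_nat)
    thus "x = y" using * by (simp add: cong_def)
  qed
  have "(\<lambda>r. 2 * r mod p) ` {1..<p} = {1..<p}" by (intro endo_inj_surj sub inj) simp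
  thus ?thesis using inj by (simp add: bij_betw_def)
qed

text \<open>Doubling permutes the nonzero residues, so the sum W is congruent to W/4 modulo p, and p
  > 3 allows 3 to be cancelled.\<close>

lemma sum_inverse_squares:
  assumes p: "p > 3"
  shows "val_ge p 1 (\<Sum>r=1..<p. 1 / of_nat (r ^ 2))"
proof -
  define W :: rat where "W = (\<Sum>r=1..<p. 1 / of_nat (r ^ 2))"
  have "W = (\<Sum>r=1..<p. 1 / of_nat ((2 * r mod p) ^ 2))"
    unfolding W_def using bij_double_mod p by (subst sum.reindex_bij_betw[symmetric]) auto
  moreover have "W / 4 = (\<Sum>r=1..<p. 1 / of_nat ((2 * r) ^ 2))"
    unfolding W_def sum_divide_distrib by (simp add: power_mult_distrib mult.commute)
  ultimately have "W - W / 4 = (\<Sum>r=1..<p. 1 / of_nat ((2 * r mod p) ^ 2) - 1 / of_nat ((2 * r) ^ 2))"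
    by (simp only: sum_subtractf)
  also have "val_ge p 1 \<dots>"
  proof (intro val_ge_sum)
    fix r assume r: "r \<in> {1..<p}"
    define a b where "a = (2 * r mod p) ^ 2" and "b = (2 * r) ^ 2"
    have "\<not> p dvd r" "\<not> p dvd 2" using r p by (auto simp: nat_dvd_not_less)
    hence "\<not> p dvd 2 * r" using prime_p by (simp add: prime_dvd_mult_iff)
    hence nd: "\<not> p dvd a" "\<not> p dvd b" unfolding a_def b_def by (simp_all only: not_dvd_power dvd_mod_iff[OF dvd_refl] not_False_eq_True)
    have "[b = a] (mod p ^ 1)" unfolding a_def b_def by (intro cong_pow) (simp add: cong_def)
    hence "val_ge p 1 (of_nat b - of_nat a)" using val_ge_cong_nat by fastforce
    moreover have "\<not> p dvd a * b" using nd prime_p by (simp add: prime_dvd_mult_iff)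
    ultimately have "val_ge p 1 ((of_nat b - of_nat a) / of_nat (a * b))" by (rule val_ge_divide_nat)
    moreover have "a \<noteq> 0" "b \<noteq> 0" using nd by (auto intro: ccontr)
    hence "(of_nat b - of_nat a) / of_nat (a * b) = 1 / of_nat a - (1 / of_nat b :: rat)"
      by (simp add: field_simps)
    ultimately show "val_ge p 1 (1 / of_nat ((2 * r mod p) ^ 2) - 1 / of_nat ((2 * r) ^ 2))"
      unfolding a_def b_def by simp
  qed
  finally have "val_ge p 1 ((W - W / 4) * of_nat 4)" by (intro val_ge_mult_0 val_ge_of_nat)
  hence "val_ge p 1 ((W - W / 4) * of_nat 4 / of_nat 3)"
    using p by (intro val_ge_divide_nat) (auto simp: nat_dvd_not_less)
  thus ?thesis by (simp add: W_def)
qed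

text \<open>Pairing r with p - r gives p/(r(p - r)), and 1/(r(p - r)) is congruent to -1/r^2 modulo
  p, so the second factor \<open>p\<close> comes from the inverse squares.\<close>

lemma wolstenholme:
  assumes p: "p > 3"
  shows "val_ge p 2 (harmonic (p - 1))"
proof (rule val_ge_2_over)
  have H: "harmonic (p - 1) = (\<Sum>r=1..<p. 1 / of_nat r)"
    unfolding harmonic_def by (intro sum.cong) (use p in auto)
  have "2 * harmonic (p - 1) = (\<Sum>r=1..<p. 1 / of_nat r) + (\<Sum>r=1..<p. 1 / of_nat (p - r))"
    unfolding H by (subst (3) sum.atLeastLessThan_rev) simp
  also have "\<dots> = of_nat p * (of_nat p * (\<Sum>r=1..<p. 1 / of_nat (r * r * (p - r))) - (\<Sum>r=1..<p. 1 / of_nat (r ^ 2)))"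
    unfolding sum.distrib[symmetric] sum_subtractf[symmetric] sum_distrib_left
  proof (intro sum.cong refl)
    fix r assume r: "r \<in> {1..<p}"
    define t where "t = p - r"
    have "p = r + t" "r > 0" "t > 0" using r by (auto simp: t_def)
    thus "1 / of_nat r + 1 / of_nat (p - r) =
        of_nat p * (of_nat p * (1 / of_nat (r * r * (p - r))) - 1 / of_nat (r ^ 2) :: rat)"
      unfolding t_def[symmetric] by (simp add: field_simps power2_eq_square)
  qed
  also have "val_ge p 2 \<dots>"
  proof -
    have "val_ge p 0 (\<Sum>r=1..<p. 1 / of_nat (r * r * (p - r)))"
      by (intro val_ge_sum val_ge_1_over_nat) (use prime_p in \<open>auto simp: prime_dvd_mult_iff nat_dvd_not_less\<close>)
    hence "val_ge p 1 (of_nat p * (\<Sum>r=1..<p. 1 / of_nat (r * r * (p - r))))"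
      by (simp add: val_ge_p_times)
    from val_ge_diff[OF this sum_inverse_squares[OF p]] show ?thesis by (simp add: val_ge_p_times)
  qed
  finally show "val_ge p 2 (2 * harmonic (p - 1))" .
qed (use p in simp)

lemma unit_harm_val_2:
  assumes "p > 3"
  shows "val_ge p 2 (unit_harm p n)"
proof -
  have "val_ge p 2 ((unit_harm p n - of_nat (n ^ 2) * harmonic (p - 1)) + of_nat (n ^ 2) * harmonic (p - 1))"
    by (intro val_ge_add val_ge_mono[OF unit_harm_cong] val_ge_0_mult' val_ge_of_nat wolstenholme)
       (use assms in auto)
  thus ?thesis by simp
qed

text \<open>In n^2 H_(p-1) the third factor \<open>p\<close> comes from H_(p-1) itself or from
  n.\<close>

lemma unit_harm_val_3:
  assumes "p > 3" "wolstenholme_prime p \<or> p dvd n"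
  shows "val_ge p 3 (unit_harm p n)"
proof -
  have "val_ge p 3 (of_nat (n ^ 2) * harmonic (p - 1))"
    using assms(2)
  proof
    assume "wolstenholme_prime p"
    thus ?thesis
      by (intro val_ge_0_mult' val_ge_of_nat padic_val_le_imp_val_ge) (simp add: wolstenholme_prime_def)
  next
    assume "p dvd n"
    hence "p ^ 1 dvd n ^ 2" by (simp add: power2_eq_square)
    from val_ge_mult[OF val_ge_of_nat_iff[THEN iffD2, OF this] wolstenholme[OF assms(1)]]
    show ?thesis by simp
  qed
  from val_ge_add[OF unit_harm_cong[of n] this] show ?thesis using assms(1) by simp
qed

text \<open>Terms with index prime to \<open>p\<close> are integral, and the multiples of
  \<open>p\<close> contribute H_q/p with q = n div p. Divisibility thus passes from n to q, which
  makes a search along base p digits possible.\<close>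

lemma harmonic_descent:
  assumes "val_ge p 0 (harmonic n)"
  shows "val_ge p 1 (harmonic (n div p))"
proof -
  define q v where "q = n div p" and "v = n mod p"
  have n: "n = p * q + v" and v: "v < p" using p_gt_1 by (auto simp: q_def v_def)
  define R where "R = unit_harm p q + (\<Sum>i=1..v. 1 / of_nat (p * q + i))"
  have R: "val_ge p 0 R" unfolding R_def
    by (intro val_ge_add unit_harm_integral val_ge_sum val_ge_1_over_nat)
       (use v coprime_block_term[of _ q] in \<open>auto simp: mult.commute\<close>)
  have "harmonic n = harmonic q / of_nat p + R"
    unfolding n harmonic_add harmonic_mult_p R_def by simp
  hence "harmonic q = of_nat p * (harmonic n - R)" by (simp add: field_simps)
  also have "val_ge p 1 \<dots>" using val_ge_diff[OF assms R] by (simp add: val_ge_p_times)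
  finally show ?thesis by (simp add: q_def)
qed

lemma harmonic_descent_1: "val_ge p 1 (harmonic n) \<Longrightarrow> val_ge p 1 (harmonic (n div p))"
  using harmonic_descent val_ge_mono[of 1 _ 0] by simp

end

section \<open>Small primes\<close>

lemma harmonic_values:
  "harmonic 1 = 1" "harmonic 2 = 3 / 2" "harmonic 3 = 11 / 6" "harmonic 7 = 363 / 140"
  "harmonic 10 = 7381 / 2520" "harmonic 22 = 19093197 / 5173168"
  by (simp_all add: eval_nat_numeral harmonic_Suc)

context prime_nat begin

lemma not_val_ge_imp_nonunit:
  assumes "val_ge p 1 (of_nat a / of_nat b)" "b \<noteq> 0"
  shows "p dvd a"
  using assms not_val_ge_1_unit by blast

end

interpretation two: prime_nat 2 by unfold_locales simp

interpretation three: prime_nat 3 by unfold_locales simp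

text \<open>Repeated halving would lead down to H_1 = 1.\<close>

lemma harmonic_even_denominator: "val_ge 2 1 (harmonic n) \<Longrightarrow> n = 0"
proof (induction n rule: less_induct)
  case (less n)
  show ?case
  proof (rule ccontr)
    assume "n \<noteq> 0"
    hence "n div 2 = 0" using less.IH[of "n div 2"] two.harmonic_descent_1[OF less.prems] by simp
    hence "n = 1" using \<open>n \<noteq> 0\<close> by simp
    thus False using less.prems two.not_val_ge_1_unit[of 1 1] harmonic_values(1) by simp
  qed
qed

text \<open>For p = 3 the value H_2 = 3/2 supplies just one factor 3, in place of Wolstenholme's
  square.\<close>

lemma unit_harm_3: "val_ge 3 1 (unit_harm 3 n)"
proof -
  have "val_ge 3 1 (of_nat 3 * (1 / of_nat 2))"
    by (intro three.val_ge_mult_0 three.val_ge_p three.val_ge_1_over_nat) simp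
  hence "val_ge 3 1 (harmonic (3 - 1))" by (simp add: harmonic_values)
  hence "val_ge 3 1 ((unit_harm 3 n - of_nat (n ^ 2) * harmonic (3 - 1)) + of_nat (n ^ 2) * harmonic (3 - 1))"
    by (intro three.val_ge_add three.val_ge_mono[OF three.unit_harm_cong] three.val_ge_0_mult'
        three.val_ge_of_nat) auto
  thus ?thesis by simp
qed

lemma harmonic_mult_3_add:
  "val_ge 3 1 (harmonic (3 * q + v)) \<longleftrightarrow>
   val_ge 3 1 (harmonic q / 3 + (\<Sum>i=1..v. 1 / of_nat (3 * q + i)))"
proof -
  have "harmonic (3 * q + v) = (harmonic q / 3 + (\<Sum>i=1..v. 1 / of_nat (3 * q + i))) + unit_harm 3 q"
    unfolding harmonic_add three.harmonic_mult_p by simp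
  thus ?thesis using three.val_ge_add[OF _ unit_harm_3, of _ q] three.val_ge_diff[OF _ unit_harm_3, of _ q]
    by (metis add_diff_cancel)
qed

text \<open>Descent through base 3 digits: the only chain of survivors is 0, 2, 7, 22, and none of
  66, 67, 68 continues it.\<close>

lemma harmonic_divisible_by_3: "val_ge 3 1 (harmonic n) \<Longrightarrow> n \<in> {0, 2, 7, 22}"
proof (induction n rule: less_induct)
  case (less n)
  define v where "v = n mod 3"
  have v: "v = 0 \<or> v = 1 \<or> v = 2" unfolding v_def by linarith
  show ?case
  proof (cases "n = 0")
    case False
    hence "n div 3 \<in> {0, 2, 7, 22}"
      using less.IH[of "n div 3"] three.harmonic_descent_1[OF less.prems] by simp
    then obtain q where q: "n = 3 * q + v" "q = 0 \<or> q = 2 \<or> q = 7 \<or> q = 22"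
      using v_def by (metis div_mult_mod_eq insertE empty_iff mult.commute)
    have val: "val_ge 3 1 (harmonic q / 3 + (\<Sum>i=1..v. 1 / of_nat (3 * q + i)))"
      using less.prems unfolding q(1) harmonic_mult_3_add .
    have unit: "\<not> val_ge 3 1 (of_nat a / of_nat b)" if "\<not> 3 dvd a" "b \<noteq> 0" for a b :: nat
      using three.not_val_ge_1_unit that by blast
    have sum12: "(\<Sum>i=Suc 0..2. g i) = g 1 + g 2" for g :: "nat \<Rightarrow> rat"
      by (simp add: numeral_2_eq_2)
    define f where "f = (\<lambda>q v. harmonic q / 3 + (\<Sum>i=1..v. 1 / of_nat (3 * q + i)))"
    \<comment> \<open>The failing children 1, 6, 8, 21, 23, 66, 67, 68; no numerator is divisible by
      3.\<close>
    have f: "f 0 1 = 1" "f 2 0 = 1 / 2" "f 2 2 = 43 / 56" "f 7 0 = 121 / 140" "f 7 2 = 33763 / 35420" "f 22 0 = 6364399 / 5173168" "f 22 1 = 431587901 / 346602256" "f 22 2 = 436684993 / 346602256"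
      by (simp_all add: f_def harmonic_values sum12)
    have "\<not> val_ge 3 1 (f 0 1)" "\<not> val_ge 3 1 (f 2 0)" "\<not> val_ge 3 1 (f 2 2)" "\<not> val_ge 3 1 (f 7 0)" "\<not> val_ge 3 1 (f 7 2)" "\<not> val_ge 3 1 (f 22 0)" "\<not> val_ge 3 1 (f 22 1)" "\<not> val_ge 3 1 (f 22 2)"
      unfolding f using unit[of 1 1] unit[of 1 2] unit[of 43 56] unit[of 121 140] unit[of 33763 35420] unit[of 6364399 5173168] unit[of 431587901 346602256] unit[of 436684993 346602256] by simp_all
    hence "(q, v) \<notin> {(0, 1), (2, 0), (2, 2), (7, 0), (7, 2), (22, 0), (22, 1), (22, 2)}" using val unfolding f_def by blast
    thus ?thesis using q v False by auto
  qed simp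
qed

section \<open>The exponents of Xi\<close>

context prime_nat begin

lemma val_ge_powi_other_prime:
  assumes "prime q" "q \<noteq> p"
  shows "val_ge p 0 (of_nat q powi n)"
proof -
  have nd: "\<not> p dvd q" using assms prime_p primes_dvd_imp_eq by blast
  show ?thesis
  proof (cases "n \<ge> 0")
    case True
    thus ?thesis using val_ge_power[OF val_ge_of_nat[of q]] by (simp add: power_int_def)
  next
    case False
    have "val_ge p 0 ((1 / of_nat q) ^ nat (- n))"
      by (intro val_ge_power val_ge_1_over_nat nd)
    thus ?thesis using False by (simp add: power_int_def power_one_over inverse_eq_divide)
  qed
qed

definition Xi_exponent :: "nat \<Rightarrow> int" where
  "Xi_exponent N = min (2 + xi p N) (padic_val p (harmonic N))"

lemma val_ge_inverse_Xi:
  assumes "N \<noteq> 7"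
  shows "val_ge p (if p \<le> N then - Xi_exponent N else 0) (1 / Xi N)"
proof (cases "N = 1")
  case True
  thus ?thesis using p_gt_1 by (simp add: Xi_def)
next
  case False
  define e where "e = (\<lambda>q. min (2 + xi q N) (padic_val q (harmonic N)))"
  have "(\<Prod>q | prime q \<and> q \<le> N. of_nat q powi (- e q) :: rat) =
      1 / (\<Prod>q | prime q \<and> q \<le> N. of_nat q powi e q)"
    by (simp add: power_int_minus inverse_eq_divide prod_dividef)
  also have "\<dots> = 1 / Xi N" using False assms by (simp add: Xi_def e_def)
  finally have Xi: "1 / Xi N = (\<Prod>q | prime q \<and> q \<le> N. of_nat q powi (- e q))" ..
  have fin: "finite {q. prime q \<and> q \<le> N}" by simp
  show ?thesis
  proof (cases "p \<le> N")
    case True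
    hence "1 / Xi N = of_nat p powi (- e p) * (\<Prod>q\<in>{q. prime q \<and> q \<le> N} - {p}. of_nat q powi (- e q))"
      unfolding Xi using prime_p by (intro prod.remove fin) simp
    also have "val_ge p (- e p) \<dots>"
      by (intro val_ge_mult_0 val_ge_p_powi val_ge_prod val_ge_powi_other_prime) auto
    finally show ?thesis using True by (simp add: e_def Xi_exponent_def)
  next
    case False
    thus ?thesis unfolding Xi using val_ge_powi_other_prime by (auto intro!: val_ge_prod)
  qed
qed

text \<open>For h <= 0 the unit sums are integral enough, and p^L, being at most N, divides
  N!.\<close>

lemma mirror_map_nonpos:
  assumes "k > 0" "N > 0" "h \<le> 0" "val_ge p h (harmonic N)"
  shows "\<exists>L. mirror_map_at_prime p N k L h"
proof -
  obtain L where L: "p ^ L \<le> N" "N < p ^ Suc L"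
    using ex_power_ivl1[of p N] p_gt_1 assms(2) by auto
  have "p ^ L dvd fact N" using L p_gt_1 by (intro dvd_fact) (auto simp: Suc_le_eq)
  hence "val_ge p (int L) (fact N)" using val_ge_of_nat_iff[of L "fact N"] by simp
  hence "mirror_map_at_prime p N k L h"
    using assms L val_ge_mono[of "int L" "fact N" "h + int L"] val_ge_mono[OF unit_harm_integral, of h]
    by unfold_locales auto
  thus ?thesis ..
qed

lemma mirror_map_large_prime:
  assumes "k > 0" "N < p"
  shows "mirror_map_at_prime p N k 0 0"
  using assms val_ge_harmonic_small[of N 0] unit_harm_integral by unfold_locales auto

lemma p_power_dvd_fact: "p ^ (N div p) dvd fact N"
proof -
  have "p ^ (N div p) dvd fact (p * (N div p))" by (simp add: fact_mult_p mult.assoc)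
  also have "\<dots> dvd (fact N :: nat)" by (intro fact_dvd) simp
  finally show ?thesis .
qed

lemma five_power_ge: "L \<ge> 2 \<Longrightarrow> L + 3 \<le> 5 ^ (L - 1)"
proof (induction L rule: dec_induct)
  case (step n)
  then obtain m where "n = Suc m" by (cases n) auto
  thus ?case using step by simp
qed simp

text \<open>H_3 = 11/6 forces p = 11. This is not a Wolstenholme prime, as H_10 has numerator 7381 =
  11^2 * 61, and 11 dividing N would mean N = 33, where H_33 is congruent to 1/6 modulo 11.\<close>

lemma Xi_exponent_le_2_if_div_eq_3:
  assumes p: "p > 3" and N: "N div p = 3" and v: "val_ge p 1 (harmonic 3)"
    and h: "val_ge p 1 (harmonic N)"
  shows "Xi_exponent N \<le> 2"
proof -
  have "val_ge p 1 (of_nat 11 / of_nat 6)" using v by (simp add: harmonic_values)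
  hence "p dvd 11" by (rule not_val_ge_imp_nonunit) simp
  hence p11: "p = 11" using prime_p primes_dvd_imp_eq[of p 11] by simp
  interpret eleven: prime_nat 11 using prime_p p11 by unfold_locales simp
  have "\<not> wolstenholme_prime 11"
  proof
    assume "wolstenholme_prime 11"
    hence "val_ge 11 3 (harmonic 10)"
      using eleven.padic_val_le_imp_val_ge[of 3 "harmonic 10"] by (simp add: wolstenholme_prime_def)
    hence "val_ge 11 (int 3) (harmonic 10 * of_nat 2520)"
      by (intro eleven.val_ge_mult_0 eleven.val_ge_of_nat) simp
    hence "val_ge 11 (int 3) (of_nat 7381)" by (simp add: harmonic_values)
    thus False unfolding eleven.val_ge_of_nat_iff by simp
  qed
  moreover have "\<not> 11 dvd N"
  proof
    assume "11 dvd N"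
    hence "N = 11 * 3" using N p11 by auto
    hence eq: "harmonic N = harmonic 3 / 11 + unit_harm 11 3"
      using eleven.harmonic_mult_p[of 3] by simp
    have "val_ge 11 1 (unit_harm 11 3)"
      by (rule eleven.val_ge_mono[OF eleven.unit_harm_val_2]) auto
    from eleven.val_ge_diff[OF h[unfolded p11] this]
    have "val_ge 11 1 (of_nat 1 / of_nat 6)" by (simp add: eq harmonic_values)
    hence "11 dvd (1::nat)" by (rule eleven.not_val_ge_imp_nonunit) simp
    thus False by simp
  qed
  ultimately have "xi p N = 0" by (simp add: xi_def p11)
  thus ?thesis by (simp add: Xi_exponent_def)
qed

lemma mirror_map_pos_large:
  assumes "k > 0" and p: "p > 3" and pN: "p \<le> N" and pos: "Xi_exponent N \<ge> 1"
  shows "\<exists>L. mirror_map_at_prime p N k L (Xi_exponent N)"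
proof -
  define h where "h = Xi_exponent N"
  define c where "c = N div p"
  have vN: "val_ge p h (harmonic N)"
    by (rule padic_val_le_imp_val_ge) (simp add: h_def Xi_exponent_def)
  have h3: "h \<le> 3" "h = 3 \<Longrightarrow> wolstenholme_prime p \<or> p dvd N"
    by (auto simp: h_def Xi_exponent_def xi_def split: if_splits)
  have vN1: "val_ge p 1 (harmonic N)" using val_ge_mono[OF vN] pos by (simp add: h_def)
  hence vc: "val_ge p 1 (harmonic c)" unfolding c_def by (rule harmonic_descent_1)
  have c0: "c \<noteq> 0" using pN p_gt_1 by (simp add: c_def div_eq_0_iff)
  \<comment> \<open>H_1 = 1 and H_2 = 3/2 have no prime above 3 in their numerators.\<close>
  have c1: "c \<noteq> 1" using vc not_val_ge_imp_nonunit[of 1 1] harmonic_values(1) by auto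
  have c2: "c \<noteq> 2"
  proof
    assume "c = 2"
    hence "val_ge p 1 (of_nat 3 / of_nat 2)" using vc by (simp add: harmonic_values)
    hence "p dvd 3" by (rule not_val_ge_imp_nonunit) simp
    thus False using p by (auto dest: dvd_imp_le)
  qed
  have c3: "h \<le> 2" if "c = 3"
    using Xi_exponent_le_2_if_div_eq_3[OF p] that vc vN1 by (simp add: h_def c_def)
  obtain L where L: "p ^ L \<le> N" "N < p ^ Suc L"
    using ex_power_ivl1[of p N] p_gt_1 pN by auto
  have "L \<noteq> 0"
  proof
    assume "L = 0"
    thus False using L(2) pN by simp
  qed
  \<comment> \<open>This suffices because p^c divides N!. For L = 1 the bound h <= 3 goes with c >=
    4, and c = 3 goes with h <= 2; for L >= 2 already c >= p^(L-1) >= L + 3.\<close>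
  have "h + int L \<le> int c"
  proof (cases "L = 1")
    case True
    have "c = 3 \<or> c \<ge> 4" using c0 c1 c2 by linarith
    thus ?thesis using True h3(1) c3 by auto
  next
    case False
    hence L2: "L \<ge> 2" using \<open>L \<noteq> 0\<close> by simp
    have p5: "p \<ge> 5"
    proof (rule ccontr)
      assume "\<not> p \<ge> 5"
      hence "p = 2 * 2" using p by simp
      thus False using prime_p prime_product[of 2 2] by simp
    qed
    have "p ^ L = p ^ (L - 1) * p" using L2 by (simp flip: power_Suc2)
    hence "p ^ (L - 1) \<le> c" using L(1) p_gt_1 by (simp add: c_def less_eq_div_iff_mult_less_eq)
    moreover have "(5::nat) ^ (L - 1) \<le> p ^ (L - 1)" by (rule power_mono) (use p5 in auto)
    ultimately have "L + 3 \<le> c" using five_power_ge[OF L2] by linarith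
    thus ?thesis using h3(1) by linarith
  qed
  moreover have "val_ge p (int c) (fact N)"
    using val_ge_of_nat_iff[of c "fact N"] p_power_dvd_fact[of N] by (simp add: c_def)
  ultimately have "val_ge p (h + int L) (fact N)" using val_ge_mono by blast
  moreover have "val_ge p h (unit_harm p (N * x))" for x
  proof (cases "h = 3")
    case True
    thus ?thesis using h3(2) unit_harm_val_3[OF p, of "N * x"] by auto
  next
    case False
    thus ?thesis using h3(1) by (intro val_ge_mono[OF unit_harm_val_2[OF p]]) simp
  qed
  ultimately have "mirror_map_at_prime p N k L h"
    using vN L(2) assms(1) by unfold_locales auto
  thus ?thesis unfolding h_def ..
qed

end

text \<open>The exceptional case at p = 3: 9 <= 22 < 27 gives L = 2, and the required 3^3 already
  divides 9!.\<close>

lemma mirror_map_22: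
  assumes "k > 0"
  shows "mirror_map_at_prime 3 22 k 2 1"
proof
  have "val_ge 3 1 (of_nat 3 * (of_nat 6364399 / of_nat 5173168))"
    by (intro three.val_ge_mult_0 three.val_ge_p three.val_ge_divide_nat three.val_ge_of_nat) simp
  thus "val_ge 3 1 (harmonic 22)" by (simp add: harmonic_values)
  have "3 ^ 3 dvd (fact 9 :: nat)" using three.p_power_dvd_fact[of 9] by simp
  hence "3 ^ 3 dvd (fact 22 :: nat)" by (rule dvd_trans) (rule fact_dvd, simp)
  thus "val_ge 3 (1 + int 2) (fact 22)" using three.val_ge_of_nat_iff[of 3 "fact 22"] by simp
qed (use assms unit_harm_3 in auto)

lemma not_val_ge_2_harmonic_22: "\<not> val_ge 3 2 (harmonic 22)"
proof
  assume "val_ge 3 2 (harmonic 22)"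
  hence "val_ge 3 (int 2) (harmonic 22 * of_nat 5173168)"
    by (intro three.val_ge_mult_0 three.val_ge_of_nat) simp
  hence "val_ge 3 (int 2) (of_nat 19093197)" by (simp add: harmonic_values)
  thus False unfolding three.val_ge_of_nat_iff by simp
qed

text \<open>The denominator 140 of H_7 is the inverse of \<open>Xi 7\<close>, so h = -v_p(140)
  serves both conditions and is never positive.\<close>

lemma (in prime_nat) Xi_7: "\<exists>h \<le> 0. val_ge p h (harmonic 7) \<and> val_ge p (- h) (1 / Xi 7)"
proof -
  have H: "val_ge p h (harmonic 7)" if "val_ge p h (1 / 140)" for h
    using val_ge_mult_0[OF that val_ge_of_nat[of 363]] by (simp add: harmonic_values)
  have Xi: "1 / Xi 7 = of_nat 140" by (simp add: Xi_def)
  show ?thesis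
  proof (cases "p dvd 140")
    case False
    thus ?thesis using H val_ge_1_over_nat[OF False] by (intro exI[of _ 0]) (simp add: Xi)
  next
    case True
    obtain m e where m: "140 = p ^ e * m" "\<not> p dvd m"
      using multiplicity_decompose'[of 140 p] prime_p not_prime_unit[of p] by (metis zero_neq_numeral)
    have "m \<noteq> 0" using m(2) by (metis dvd_0_right)
    have "(140::rat) = of_nat (p ^ e * m)" using m(1) by (metis of_nat_numeral)
    hence eq: "1 / 140 = of_nat p powi (- int e) * (1 / of_nat m :: rat)"
      by (simp add: power_int_minus field_simps)
    have "val_ge p (- int e) (1 / 140)" unfolding eq
      by (intro val_ge_mult_0 val_ge_p_powi val_ge_1_over_nat m)
    moreover have "val_ge p (int e) (of_nat 140)" unfolding val_ge_of_nat_iff using m(1) by (metis dvd_triv_left)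
    ultimately show ?thesis using H by (intro exI[of _ "- int e"]) (simp add: Xi)
  qed
qed

lemma mirror_map_at_prime_exists:
  assumes "prime p" "N > 0" "k > 0"
  shows "\<exists>L h. mirror_map_at_prime p N k L h \<and> val_ge p (- h) (1 / Xi N)"
proof -
  interpret prime_nat p using assms(1) by unfold_locales
  show ?thesis
  proof (cases "N = 7")
    case True
    obtain h where h: "h \<le> 0" "val_ge p h (harmonic 7)" "val_ge p (- h) (1 / Xi 7)"
      using Xi_7 by blast
    from mirror_map_nonpos[OF assms(3) _ h(1,2)] h(3) show ?thesis using True by auto
  next
    case N7: False
    note Xi = val_ge_inverse_Xi[OF N7]
    define h where "h = Xi_exponent N"
    have vN: "val_ge p h (harmonic N)"
      by (rule padic_val_le_imp_val_ge) (simp add: h_def Xi_exponent_def)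
    consider "N < p" | "p \<le> N" "h \<le> 0" | "p \<le> N" "h \<ge> 1" "p = 2"
      | "p \<le> N" "h \<ge> 1" "p = 3" | "p \<le> N" "h \<ge> 1" "p > 3"
      using p_gt_1 by linarith
    thus ?thesis
    proof cases
      case 1
      thus ?thesis using mirror_map_large_prime[OF assms(3)] Xi by fastforce
    next
      case 2
      thus ?thesis using mirror_map_nonpos[OF assms(3,2) _ vN] Xi by (auto simp: h_def)
    next
      case 3
      \<comment> \<open>The case is empty: 2 never divides the numerator of H_N for N >= 1.\<close>
      thus ?thesis using harmonic_even_denominator[of N] val_ge_mono[OF vN, of 1] assms(2) by simp
    next
      case 4
      hence "N \<in> {0, 2, 7, 22}" using harmonic_divisible_by_3[of N] val_ge_mono[OF vN, of 1] by simp
      \<comment> \<open>p <= N rules out 0 and 2, and N = 7 has been set aside.\<close>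
      hence N: "N = 22" using N7 4 by auto
      have "h \<le> 1"
        using not_val_ge_2_harmonic_22 val_ge_mono[OF vN, of 2] 4 N by (cases "h \<ge> 2") auto
      hence "h = 1" using 4 by simp
      thus ?thesis using mirror_map_22[OF assms(3)] Xi 4 N by (auto simp: h_def)
    next
      case 5
      then obtain L where "mirror_map_at_prime p N k L h"
        using mirror_map_pos_large[OF assms(3)] unfolding h_def by blast
      thus ?thesis using Xi 5 by (auto simp: h_def)
    qed
  qed
qed

section \<open>From single primes to integrality\<close>

lemma (in prime_nat) fps_ge_cancel:
  assumes "fps_ge 0 f" "f $ 0 = 1" "fps_ge n (f * g)"
  shows "fps_ge n g"
proof -
  have "val_ge p n (g $ i)" for i
  proof (induction i rule: less_induct)
    case (less i)
    have "(f * g) $ i = g $ i + (\<Sum>j=1..i. f $ j * g $ (i - j))"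
      using assms(2) by (simp add: fps_mult_nth sum.atLeast_Suc_atMost)
    hence "g $ i = (f * g) $ i - (\<Sum>j=1..i. f $ j * g $ (i - j))" by simp
    also have "val_ge p n \<dots>"
      using assms less by (intro val_ge_diff val_ge_sum val_ge_0_mult') (auto simp: fps_ge_def)
    finally show ?case .
  qed
  thus ?thesis by (simp add: fps_ge_def)
qed

theorem theorem3:
  fixes N k :: nat
  assumes "N > 0" and "k > 0"
  shows "\<forall>n. fps_nth (fps_rat_power (q_series N k) (1 / (Xi N * fact N ^ k))) n \<in> \<int>"
proof (intro allI rat_Ints_if_val_ge)
  fix n p :: nat
  assume "prime p"
  define F G where "F = F_series N k" and "G = G_series N k"
  define \<phi> where "\<phi> = G / F"
  define c where "c = 1 / (Xi N * fact N ^ k)"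
  define g where "g = fps_const c * \<phi>"
  have F0: "F $ 0 = 1" and G0: "G $ 0 = 0" by (simp_all add: F_def F_series_def G_def G_series_def)
  have FG: "F * \<phi> = G" using F0 by (simp add: \<phi>_def fps_divide_unit inverse_mult_eq_1' mult.left_commute)
  have \<phi>0: "\<phi> $ 0 = 0" using FG F0 G0 by (metis fps_mult_nth_0 mult_1)
  have g0: "g $ 0 = 0" using \<phi>0 by (simp add: g_def)
  obtain L h where at_p: "mirror_map_at_prime p N k L h" and Xi: "val_ge p (- h) (1 / Xi N)"
    using mirror_map_at_prime_exists[OF \<open>prime p\<close> assms] by blast
  interpret mirror_map_at_prime p N k L h by (rule at_p)
  have X0: "(fps_X ^ p :: rat fps) $ 0 = 0" using p_gt_1 by simp
  have F: "fps_ge 0 F"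
    unfolding fps_ge_def F_def F_series_nth by (intro allI val_ge_power multinom_integral)
  hence FX: "fps_ge 0 (F oo fps_X ^ p)"
    unfolding fps_ge_def using p_gt_1 by (simp add: fps_compose_X_power_nth)
  have GX: "(F oo fps_X ^ p) * (\<phi> oo fps_X ^ p) = G oo fps_X ^ p"
    using FG by (simp flip: fps_compose_mult_distrib[OF X0])
  define D where "D = F * (G oo fps_X ^ p) - of_nat p * (G * (F oo fps_X ^ p))"
  \<comment> \<open>Multiplying by F(z) F(z^p) clears the denominators of G/F; this product is
    integral with constant term 1 and can be cancelled afterwards.\<close>
  have D: "F * (F oo fps_X ^ p) * ((g oo fps_X ^ p) - of_nat p * g) = fps_const c * D"
  proof -
    have "F * (F oo fps_X ^ p) * ((g oo fps_X ^ p) - of_nat p * g) = fps_const c *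
        (F * ((F oo fps_X ^ p) * (\<phi> oo fps_X ^ p)) - of_nat p * ((F * \<phi>) * (F oo fps_X ^ p)))"
      by (simp add: g_def fps_compose_mult_distrib[OF X0] algebra_simps)
    thus ?thesis unfolding GX FG D_def .
  qed
  have "fps_ge 1 (fps_const c * D)"
    unfolding fps_ge_def
  proof
    fix i
    \<comment> \<open>The loss p^h from 1/Xi against the gain p^(h+1) leaves the single factor
      \<open>p\<close> that Dwork's criterion requires.\<close>
    have "val_ge p (- h + (h + 1)) (1 / Xi N * (D $ i / fact N ^ k))"
      unfolding D_def F_def G_def by (intro val_ge_mult Xi FG_congruence)
    thus "val_ge p 1 ((fps_const c * D) $ i)" by (simp add: c_def)
  qed
  hence "fps_ge 1 ((g oo fps_X ^ p) - of_nat p * g)"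
    unfolding D[symmetric] by (rule fps_ge_cancel[OF fps_ge_mult_0[OF F FX], rotated]) (simp add: F0)
  from dwork_fps_exp[OF g0 this] have "val_ge p 0 ((fps_exp 1 oo g) $ n)"
    by (simp add: fps_ge_def)
  moreover have "fps_rat_power (q_series N k) c = fps_exp 1 oo g"
    unfolding q_series_def g_def F_def[symmetric] G_def[symmetric] \<phi>_def[symmetric]
    by (rule fps_rat_power_exp[OF \<phi>0])
  ultimately show "val_ge p 0 (fps_nth (fps_rat_power (q_series N k) (1 / (Xi N * fact N ^ k))) n)"
    by (simp only: c_def)
qed

end
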